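(* Let $n\ge 2$ and let $B\subset\mathbb{R}^n$ be a maximal lattice-free simplicial polytope. Then $B$ is either a body with a unique lifting for all $f\in\operatorname{int}(B)$, or a body with multiple liftings for all $f\in\operatorname{int}(B)$.
   Context: A lattice-free convex set in $\mathbb{R}^n$ is a convex set containing no point of $\mathbb{Z}^n$ in its interior; it is maximal if it is not properly contained in another lattice-free convex set. A maximal lattice-free convex body is a compact, full-dimensional maximal lattice-free convex set (it is a polytope). A polytope is simplicial if every facet is a simplex. Let $f\in\mathbb{R}^n\setminus\mathbb{Z}^n$. A function $\psi:\mathbb{R}^n\to\mathbb{R}_+$ is valid for the continuous infinite relaxation if $\sum_r\psi(r)s_r\ge 1$ for every finitely supported $s:\mathbb{R}^n\to\mathbb{R}_+$ with $f+\sum_r r s_r\in\mathbb{Z}^n$. A function $\pi:\mathbb{R}^n\to\mathbb{R}_+$ is valid for the integer infinite relaxation if $\sum_r\pi(r)s_r\ge 1$ for every finitely supported $s:\mathbb{R}^n\to\mathbb{Z}_+$ with $f+\sum_r r s_r\in\mathbb{Z}^n$. Given $\psi$ valid for the continuous relaxation, a lifting of $\psi$ is a function $\pi\le\psi$ (pointwise) that is valid for the integer relaxation; a minimal lifting is a lifting $\pi$ such that no lifting $\pi'\ne\pi$ satisfies $\pi'\le\pi$ pointwise. Given a maximal lattice-free convex body $B$ and $f\in\operatorname{int}(B)$, write uniquely $B=\{x\in\mathbb{R}^n : a^i\cdot(x-f)\le 1,\ i\in I\}$ with $I$ finite and every inequality facet-defining, and set $\psi(r)=\max_{i\in I}a^i\cdot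 r$ (the gauge of $B-f$), which is valid for the continuous relaxation. $B$ is a body with a unique lifting for all $f\in\operatorname{int}(B)$ if for every $f\in\operatorname{int}(B)$ the corresponding $\psi$ has a unique minimal lifting. $B$ is a body with multiple liftings for all $f\in\operatorname{int}(B)$ if for every $f\in\operatorname{int}(B)$ the corresponding $\psi$ has more than one minimal lifting. *)

theory Defs
  imports "HOL-Analysis.Analysis"
begin

(* The lattice Z^n in R^n, with n = CARD('n). *)
definition integer_points :: "(real ^ 'n) set" where
  "integer_points = {x. \<forall>i. x $ i \<in> \<int>}"

definition lattice_free :: "(real ^ 'n) set \<Rightarrow> bool" where
  "lattice_free K \<longleftrightarrow> convex K \<and> interior K \<inter> integer_points = {}"

definition maximal_lattice_free :: "(real ^ 'n) set \<Rightarrow> bool" where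
  "maximal_lattice_free K \<longleftrightarrow> lattice_free K \<and> \<not> (\<exists>L. lattice_free L \<and> K \<subset> L)"

definition maximal_lattice_free_body :: "(real ^ 'n) set \<Rightarrow> bool" where
  "maximal_lattice_free_body B \<longleftrightarrow>
     maximal_lattice_free B \<and> compact B \<and> aff_dim B = int CARD('n)"

definition simplicial_polytope :: "(real ^ 'n) set \<Rightarrow> bool" where
  "simplicial_polytope P \<longleftrightarrow> polytope P \<and> (\<forall>F. F facet_of P \<longrightarrow> (\<exists>k. k simplex F))"

definition valid_continuous :: "real ^ 'n \<Rightarrow> (real ^ 'n \<Rightarrow> real) \<Rightarrow> bool" where
  "valid_continuous f \<psi> \<longleftrightarrow>
     (\<forall>r. 0 \<le> \<psi> r) \<and>
     (\<forall>s :: real ^ 'n \<Rightarrow> real.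
        (\<forall>r. 0 \<le> s r) \<longrightarrow> finite {r. s r \<noteq> 0} \<longrightarrow>
        f + (\<Sum>r | s r \<noteq> 0. s r *\<^sub>R r) \<in> integer_points \<longrightarrow>
        (\<Sum>r | s r \<noteq> 0. \<psi> r * s r) \<ge> 1)"

definition valid_integer :: "real ^ 'n \<Rightarrow> (real ^ 'n \<Rightarrow> real) \<Rightarrow> bool" where
  "valid_integer f \<pi> \<longleftrightarrow>
     (\<forall>r. 0 \<le> \<pi> r) \<and>
     (\<forall>s :: real ^ 'n \<Rightarrow> nat.
        finite {r. s r \<noteq> 0} \<longrightarrow>
        f + (\<Sum>r | s r \<noteq> 0. real (s r) *\<^sub>R r) \<in> integer_points \<longrightarrow>
        (\<Sum>r | s r \<noteq> 0. \<pi> r * real (s r)) \<ge> 1)"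

(* Liftings are considered only for functions \<psi> that are valid for the continuous relaxation. *)
definition lifting :: "real ^ 'n \<Rightarrow> (real ^ 'n \<Rightarrow> real) \<Rightarrow> (real ^ 'n \<Rightarrow> real) \<Rightarrow> bool" where
  "lifting f \<psi> \<pi> \<longleftrightarrow> valid_continuous f \<psi> \<and> valid_integer f \<pi> \<and> \<pi> \<le> \<psi>"

definition minimal_lifting :: "real ^ 'n \<Rightarrow> (real ^ 'n \<Rightarrow> real) \<Rightarrow> (real ^ 'n \<Rightarrow> real) \<Rightarrow> bool" where
  "minimal_lifting f \<psi> \<pi> \<longleftrightarrow>
     lifting f \<psi> \<pi> \<and> \<not> (\<exists>\<pi>'. lifting f \<psi> \<pi>' \<and> \<pi>' \<noteq> \<pi> \<and> \<pi>' \<le> \<pi>)"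

definition facet_description :: "(real ^ 'n) set \<Rightarrow> real ^ 'n \<Rightarrow> (real ^ 'n) set \<Rightarrow> bool" where
  "facet_description B f A \<longleftrightarrow>
     finite A \<and> B = {x. \<forall>a\<in>A. a \<bullet> (x - f) \<le> 1} \<and>
     (\<forall>a\<in>A. (B \<inter> {x. a \<bullet> (x - f) = 1}) facet_of B)"

(* Uniqueness of the facet description, and its existence when f is an interior point of a
   polyhedron B, are established in facet_description_unique below. *)
definition facet_normals :: "(real ^ 'n) set \<Rightarrow> real ^ 'n \<Rightarrow> (real ^ 'n) set" where
  "facet_normals B f = (THE A. facet_description B f A)"

lemma facet_normal_unique:
  fixes a b :: "real ^ 'n"
  assumes f: "f \<in> interior B"
    and F: "(B \<inter> {x. a \<bullet> (x - f) = 1}) facet_of B" (is "?F facet_of B")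
    and FG: "B \<inter> {x. a \<bullet> (x - f) = 1} \<subseteq> {x. b \<bullet> (x - f) = 1}"
  shows "a = b"
proof -
  have aff: "aff_dim B = int CARD('n)"
    using f aff_dim_nonempty_interior[of B] by auto
  have ne: "?F \<noteq> {}" using F by (simp add: facet_of_def)
  have a0: "a \<noteq> 0" and b0: "b \<noteq> 0" using ne FG by auto
  have H: "{x. c \<bullet> (x - f) = 1} = {x. c \<bullet> x = 1 + c \<bullet> f}" for c
    by (auto simp: algebra_simps)
  have hull: "affine hull ?F = {x. c \<bullet> (x - f) = 1}"
    if "c \<noteq> 0" "?F \<subseteq> {x. c \<bullet> (x - f) = 1}" for c
  proof -
    have "affine hull ?F = affine hull {x. c \<bullet> (x - f) = 1}"
    proof (rule aff_dim_eq_full_gen[THEN iffD1, rotated])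
      show "aff_dim ?F = aff_dim {x. c \<bullet> (x - f) = 1}"
        using F aff \<open>c \<noteq> 0\<close> by (simp add: facet_of_def H aff_dim_hyperplane)
    qed (use that in auto)
    also have "\<dots> = {x. c \<bullet> (x - f) = 1}"
      by (simp add: H affine_hyperplane hull_same)
    finally show ?thesis .
  qed
  have eq: "{x. a \<bullet> (x - f) = 1} = {x. b \<bullet> (x - f) = 1}"
    using hull[OF a0] hull[OF b0] FG by auto
  have iff: "a \<bullet> (x - f) = 1 \<longleftrightarrow> b \<bullet> (x - f) = 1" for x
    using eq by blast
  have "b \<bullet> a = a \<bullet> a"
    using iff[of "f + a /\<^sub>R (a \<bullet> a)"] a0 by (simp add: field_simps)
  moreover have "a \<bullet> b = b \<bullet> b"
    using iff[of "f + b /\<^sub>R (b \<bullet> b)"] b0 by (simp add: field_simps)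
  ultimately have "(a - b) \<bullet> (a - b) = 0" by (simp add: inner_diff inner_commute)
  then show ?thesis by simp
qed

lemma facet_description_subset:
  fixes B :: "(real ^ 'n) set"
  assumes f: "f \<in> interior B"
    and A: "facet_description B f A" and A': "facet_description B f A'"
  shows "A \<subseteq> A'"
proof
  fix a assume a: "a \<in> A"
  let ?F = "B \<inter> {x. a \<bullet> (x - f) = 1}"
  have F: "?F facet_of B" and fin: "finite A'" and B: "B = {x. \<forall>b\<in>A'. b \<bullet> (x - f) \<le> 1}"
    and F': "\<And>b. b \<in> A' \<Longrightarrow> (B \<inter> {x. b \<bullet> (x - f) = 1}) facet_of B"
    using A A' a by (auto simp: facet_description_def)
  have "convex ?F" using F by (meson facet_of_imp_face_of face_of_imp_convex)
  then obtain x where x: "x \<in> rel_interior ?F"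
    using F rel_interior_eq_empty by (fastforce simp: facet_of_def)
  then have xF: "x \<in> ?F" using rel_interior_subset by blast
  have "\<exists>b\<in>A'. b \<bullet> (x - f) = 1"
  proof (rule ccontr)
    assume "\<not> ?thesis"
    then have lt: "x \<in> (\<Inter>b\<in>A'. {y. b \<bullet> (y - f) < 1})"
      using xF B by fastforce
    have "open (\<Inter>b\<in>A'. {y. b \<bullet> (y - f) < 1})"
      using fin by (intro open_INT ballI open_Collect_less continuous_intros)
    moreover have "(\<Inter>b\<in>A'. {y. b \<bullet> (y - f) < 1}) \<subseteq> B" using B by fastforce
    ultimately have "x \<in> interior B" using lt interiorI by blast
    then have "?F \<inter> interior B \<noteq> {}" using xF by auto
    moreover have "?F \<noteq> B" using F by auto
    ultimately show False
      using face_of_disjoint_interior[OF facet_of_imp_face_of[OF F]] by simp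
  qed
  then obtain b where b: "b \<in> A'" "b \<bullet> (x - f) = 1" by blast
  have "?F \<subseteq> B \<inter> {x. b \<bullet> (x - f) = 1}"
    using subset_of_face_of[OF facet_of_imp_face_of[OF F'[OF b(1)]], of ?F] x xF b by auto
  then show "a \<in> A'"
    using facet_normal_unique[OF f F] b(1) by blast
qed

lemma facet_description_exists:
  fixes B :: "(real ^ 'n) set"
  assumes B: "polyhedron B" and f: "f \<in> interior B"
  shows "\<exists>A. facet_description B f A"
proof -
  have "aff_dim B = int CARD('n)"
    using f aff_dim_nonempty_interior[of B] by auto
  then have hull: "affine hull B = UNIV" using aff_dim_eq_full[of B] by simp
  obtain \<H> where fin: "finite \<H>" and seq: "B = affine hull B \<inter> \<Inter>\<H>"
    and faces: "\<And>h. h \<in> \<H> \<Longrightarrow> \<exists>a b. a \<noteq> 0 \<and> h = {x. a \<bullet> x \<le> b}"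
    and min: "\<And>\<H>'. \<H>' \<subset> \<H> \<Longrightarrow> B \<subset> affine hull B \<inter> \<Inter>\<H>'"
    using B by (simp add: polyhedron_Int_affine_minimal) meson
  then obtain a b where ab: "\<And>h. h \<in> \<H> \<Longrightarrow> a h \<noteq> 0 \<and> h = {x. a h \<bullet> x \<le> b h}"
    by metis
  have facet: "(B \<inter> {x. a h \<bullet> x = b h}) facet_of B" if "h \<in> \<H>" for h
    using facet_of_polyhedron_explicit[OF fin seq ab min] that by blast
  have pos: "b h - a h \<bullet> f > 0" if "h \<in> \<H>" for h
  proof -
    have "B \<subseteq> {x. a h \<bullet> x \<le> b h}" using ab that by (subst seq) blast
    then have "interior B \<subseteq> interior {x. a h \<bullet> x \<le> b h}" by (rule interior_mono)
    also have "\<dots> = {x. a h \<bullet> x < b h}"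
      by (rule interior_halfspace_le) (use ab that in blast)
    finally show ?thesis using f by auto
  qed
  define c where "c h = a h /\<^sub>R (b h - a h \<bullet> f)" for h
  have c: "c h \<bullet> (x - f) = (a h \<bullet> x - a h \<bullet> f) / (b h - a h \<bullet> f)" for h x
    by (simp add: c_def inner_diff_right divide_inverse algebra_simps)
  have le: "c h \<bullet> (x - f) \<le> 1 \<longleftrightarrow> a h \<bullet> x \<le> b h"
    and eq: "c h \<bullet> (x - f) = 1 \<longleftrightarrow> a h \<bullet> x = b h" if "h \<in> \<H>" for h x
    using pos[OF that] by (auto simp: c pos_divide_le_eq divide_eq_eq)
  have "B = \<Inter>\<H>" using seq hull by simp
  also have "\<dots> = {x. \<forall>n\<in>c ` \<H>. n \<bullet> (x - f) \<le> 1}"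
  proof -
    have "x \<in> h \<longleftrightarrow> c h \<bullet> (x - f) \<le> 1" if "h \<in> \<H>" for h x
      using le[OF that] ab[OF that] by blast
    then show ?thesis by blast
  qed
  finally have "B = {x. \<forall>n\<in>c ` \<H>. n \<bullet> (x - f) \<le> 1}" .
  then have "facet_description B f (c ` \<H>)"
    unfolding facet_description_def using fin facet eq by auto
  then show ?thesis by blast
qed

lemma facet_description_unique:
  fixes B :: "(real ^ 'n) set"
  assumes "polyhedron B" "f \<in> interior B"
  shows "\<exists>!A. facet_description B f A"
  using facet_description_exists[OF assms] facet_description_subset[OF assms(2)]
  by (meson subset_antisym)

lemma facet_description_facet_normals:
  fixes B :: "(real ^ 'n) set"
  assumes "polyhedron B" "f \<in> interior B"
  shows "facet_description B f (facet_normals B f)"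
  unfolding facet_normals_def by (rule theI'[OF facet_description_unique[OF assms]])

(* The gauge of B - f; the maximum is over a finite nonempty set if B is a polytope of positive
   dimension and f is an interior point of B. *)
definition body_gauge :: "(real ^ 'n) set \<Rightarrow> real ^ 'n \<Rightarrow> real ^ 'n \<Rightarrow> real" where
  "body_gauge B f r = Max ((\<lambda>a. a \<bullet> r) ` facet_normals B f)"

definition unique_lifting_body :: "(real ^ 'n) set \<Rightarrow> bool" where
  "unique_lifting_body B \<longleftrightarrow>
     maximal_lattice_free_body B \<and>
     (\<forall>f \<in> interior B. \<exists>!\<pi>. minimal_lifting f (body_gauge B f) \<pi>)"

definition multiple_lifting_body :: "(real ^ 'n) set \<Rightarrow> bool" where
  "multiple_lifting_body B \<longleftrightarrow>
     maximal_lattice_free_body B \<and>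
     (\<forall>f \<in> interior B. \<exists>\<pi> \<pi>'. \<pi> \<noteq> \<pi>' \<and>
        minimal_lifting f (body_gauge B f) \<pi> \<and> minimal_lifting f (body_gauge B f) \<pi>')"

end

(* Let psi be the gauge of B - f, let R(f) be the union over lattice points x of the regions
   {r. psi r + psi (x - f - r) <= 1}, and call r covered if it lies in R(f) + Z^n.

   Every lifting agrees with psi on R(f), and minimal liftings are Z^n-periodic, so psi has only one
   minimal lifting if every point is covered. Conversely, a unique minimal lifting takes at every r
   the least value that validity permits if psi is lowered at r alone. Minimal liftings satisfy
   pi r + pi (- f - r) = 1, and this forces all points outside a countable set to be covered,
   whereas the set of uncovered points is open.

   Whether all points are covered does not depend on f: up to a null set R(f) is the disjoint union
   of pieces belonging to the facets of B, pieces of different facets do not meet modulo Z^n, and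
   the linear map r |-> r + (a . r) (f - g) carries the piece of the facet with normal a for f to
   that for g and respects congruence modulo Z^n. So the volume of R(f) / Z^n is an affine function
   of f on the interior of B; if it takes its maximal value 1 at an interior point, it is constant. *)

theory Submission
  imports Defs
begin

subsection \<open>Minimal liftings\<close>

text \<open>In the volume argument only covering for \<open>f\<close> is assumed, so the volume of
  the region for another interior point is never computed: one set of representatives modulo the
  lattice is chosen for \<open>f\<close>, cut along the facets, and sheared towards each
  \<open>g\<close>. The shear has determinant \<open>1 + a \<bullet> (f - g)\<close>, and this is
  where affine dependence on \<open>g\<close> comes from. The shear does not preserve the lattice.
  Congruence survives because congruent points of the pieces of one facet have equal values under
  its normal, and on a level set of that normal the shear is a translation.\<close>

lemma integer_points_0 [simp]: "0 \<in> integer_points"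
  by (simp add: integer_points_def)

lemma integer_points_add: "x \<in> integer_points \<Longrightarrow> y \<in> integer_points \<Longrightarrow> x + y \<in> integer_points"
  by (simp add: integer_points_def)

lemma integer_points_minus: "x \<in> integer_points \<Longrightarrow> - x \<in> integer_points"
  by (simp add: integer_points_def)

lemma integer_points_diff: "x \<in> integer_points \<Longrightarrow> y \<in> integer_points \<Longrightarrow> x - y \<in> integer_points"
  by (simp add: integer_points_def)

lemma integer_points_scale: "x \<in> integer_points \<Longrightarrow> real k *\<^sub>R x \<in> integer_points"
  by (simp add: integer_points_def)

lemma countable_integer_points: "countable (integer_points :: (real ^ 'n) set)"
proof -
  have "(integer_points :: (real ^ 'n) set) \<subseteq> range (\<lambda>h :: 'n \<Rightarrow> int. \<chi> i. of_int (h i))"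
  proof
    fix x :: "real ^ 'n" assume "x \<in> integer_points"
    then have "x = (\<chi> i. of_int \<lfloor>x $ i\<rfloor>)"
      by (auto simp: integer_points_def vec_eq_iff)
    then show "x \<in> range (\<lambda>h :: 'n \<Rightarrow> int. \<chi> i. of_int (h i))"
      by (rule range_eqI[of _ _ "\<lambda>i. \<lfloor>x $ i\<rfloor>"])
  qed
  then show ?thesis by (rule countable_subset) simp
qed

lemma finite_integer_points_bounded: "finite {x \<in> integer_points. norm (x :: real ^ 'n) \<le> K}"
proof -
  have "{x \<in> integer_points. norm (x :: real ^ 'n) \<le> K}
      \<subseteq> (\<lambda>h :: 'n \<Rightarrow> int. \<chi> i. of_int (h i)) ` (UNIV \<rightarrow>\<^sub>E {-\<lceil>K\<rceil>..\<lceil>K\<rceil>})"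
  proof
    fix x :: "real ^ 'n" assume x: "x \<in> {x \<in> integer_points. norm x \<le> K}"
    have "\<bar>x $ i\<bar> \<le> K" for i using component_le_norm_cart[of x i] x by auto
    then have "\<lfloor>x $ i\<rfloor> \<in> {-\<lceil>K\<rceil>..\<lceil>K\<rceil>}" for i
      by (smt (verit) atLeastAtMost_iff ceiling_le_iff floor_le_iff le_floor_iff
          le_of_int_ceiling of_int_minus)
    moreover have "x = (\<chi> i. of_int \<lfloor>x $ i\<rfloor>)"
      using x by (auto simp: integer_points_def vec_eq_iff)
    ultimately show "x \<in> (\<lambda>h :: 'n \<Rightarrow> int. \<chi> i. of_int (h i)) ` (UNIV \<rightarrow>\<^sub>E {-\<lceil>K\<rceil>..\<lceil>K\<rceil>})"
      by (intro image_eqI[of _ _ "\<lambda>i. \<lfloor>x $ i\<rfloor>"]) auto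
  qed
  then show ?thesis by (rule finite_subset) (intro finite_imageI finite_PiE; simp)
qed

section \<open>Feasible integer combinations as multisets\<close>

lemma sum_count_scaleR:
  fixes g :: "'a \<Rightarrow> 'b :: real_vector"
  shows "(\<Sum>x\<in>set_mset M. real (count M x) *\<^sub>R g x) = (\<Sum>x\<in>#M. g x)"
proof -
  \<comment> \<open>The index set is enlarged to a fixed finite \<open>A\<close>, because
    \<open>set_mset M\<close> changes during the induction on \<open>M\<close>.\<close>
  have "(\<Sum>x\<in>A. real (count M x) *\<^sub>R g x) = (\<Sum>x\<in>#M. g x)"
    if "finite A" "set_mset M \<subseteq> A" for A
    using that
  proof (induction M)
    case (add a M)
    have "(\<Sum>x\<in>A. real (count (add_mset a M) x) *\<^sub>R g x)
        = (\<Sum>x\<in>A. real (count M x) *\<^sub>R g x + (if x = a then g x else 0))"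
      by (intro sum.cong refl) (simp add: scaleR_left_distrib)
    also have "\<dots> = (\<Sum>x\<in>#M. g x) + g a"
      using add by (simp add: sum.distrib)
    finally show ?case by (simp add: add.commute)
  qed simp
  then show ?thesis by simp
qed

lemma sum_mset_repeat_mset:
  fixes g :: "'a \<Rightarrow> 'b :: real_vector"
  shows "(\<Sum>x\<in>#repeat_mset k M. g x) = real k *\<^sub>R (\<Sum>x\<in>#M. g x)"
  by (induction k) (auto simp: algebra_simps)

lemma of_nat_times_vec: "of_nat k * (x :: real ^ 'n) = real k *\<^sub>R x" "x * of_nat k = real k *\<^sub>R x"
  by (simp_all add: vec_eq_iff of_nat_index)

text \<open>A finitely supported function into the naturals is a multiset. In this form, exchanging
  some summands of a combination for others is multiset arithmetic.\<close>

lemma valid_integer_mset: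
  "valid_integer f \<pi> \<longleftrightarrow> (\<forall>r. 0 \<le> \<pi> r) \<and>
     (\<forall>M. f + (\<Sum>r\<in>#M. r) \<in> integer_points \<longrightarrow> 1 \<le> (\<Sum>r\<in>#M. \<pi> r))" (is "?L \<longleftrightarrow> ?R")
proof
  assume L: ?L
  have "1 \<le> (\<Sum>r\<in>#M. \<pi> r)" if "f + (\<Sum>r\<in>#M. r) \<in> integer_points" for M
  proof -
    have eq: "{r. count M r \<noteq> 0} = set_mset M" by (auto simp: count_eq_zero_iff)
    have "finite {r. count M r \<noteq> 0} \<longrightarrow> f + (\<Sum>r | count M r \<noteq> 0. real (count M r) *\<^sub>R r) \<in> integer_points
        \<longrightarrow> 1 \<le> (\<Sum>r | count M r \<noteq> 0. \<pi> r * real (count M r))"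
      using L unfolding valid_integer_def by blast
    then show ?thesis
      using that sum_count_scaleR[of M \<pi>] sum_count_scaleR[of M "\<lambda>r. r"]
      by (simp add: eq mult.commute)
  qed
  then show ?R using L by (auto simp: valid_integer_def)
next
  assume R: ?R
  have "1 \<le> (\<Sum>r | s r \<noteq> 0. \<pi> r * real (s r))"
    if fin: "finite {r. s r \<noteq> 0}"
      and s: "f + (\<Sum>r | s r \<noteq> 0. real (s r) *\<^sub>R r) \<in> integer_points" for s :: "real ^ 'a \<Rightarrow> nat"
  proof -
    define M where "M = Abs_multiset s"
    have c: "count M = s" unfolding M_def using fin by (simp add: count_Abs_multiset)
    have eq: "{r. s r \<noteq> 0} = set_mset M" by (simp add: set_eq_iff c[symmetric] count_eq_zero_iff del: count_greater_zero_iff)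
    show ?thesis
      using R s[unfolded eq] sum_count_scaleR[of M \<pi>] sum_count_scaleR[of M "\<lambda>r. r"]
      unfolding eq by (simp add: c mult.commute)
  qed
  then show ?L using R by (auto simp: valid_integer_def)
qed

lemma valid_integer_mset_ge:
  "valid_integer f \<pi> \<Longrightarrow> f + (\<Sum>r\<in>#M. r) \<in> integer_points \<Longrightarrow> 1 \<le> (\<Sum>r\<in>#M. \<pi> r)"
  by (simp add: valid_integer_mset)

lemma valid_integer_nonneg: "valid_integer f \<pi> \<Longrightarrow> 0 \<le> \<pi> r"
  by (simp add: valid_integer_def)

text \<open>Combinations that avoid \<open>r\<close> keep their cost, so only those with
  \<open>k > 0\<close> copies of \<open>r\<close> need a test. As \<open>N\<close> may contain
  \<open>r\<close> again, applications can treat it as an arbitrary remainder.\<close>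

lemma valid_integer_update:
  assumes valid: "valid_integer f \<phi>" and v: "0 \<le> v"
    and upd: "\<And>k N. k > 0 \<Longrightarrow> f + real k *\<^sub>R r + (\<Sum>x\<in>#N. x) \<in> integer_points \<Longrightarrow>
        1 \<le> real k * v + (\<Sum>x\<in>#N. \<phi> x)"
  shows "valid_integer f (\<phi>(r := v))"
  unfolding valid_integer_mset
proof (intro conjI allI impI)
  show "0 \<le> (\<phi>(r := v)) x" for x using valid v by (auto simp: valid_integer_def)
  fix M assume M: "f + (\<Sum>x\<in>#M. x) \<in> integer_points"
  define k where "k = count M r"
  define N where "N = filter_mset (\<lambda>x. x \<noteq> r) M"
  have MN: "M = repeat_mset k {#r#} + N"
    by (intro multiset_eqI) (auto simp: k_def N_def)
  have "(\<Sum>x\<in>#N. (\<phi>(r := v)) x) = (\<Sum>x\<in>#N. \<phi> x)"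
    by (intro arg_cong[of _ _ sum_mset] image_mset_cong) (auto simp: N_def)
  moreover have "1 \<le> real k * v + (\<Sum>x\<in>#N. \<phi> x)"
  proof (cases "k = 0")
    case True
    then show ?thesis using valid M by (auto simp: MN valid_integer_mset)
  next
    case False
    then show ?thesis using upd M by (simp add: MN sum_mset_repeat_mset[of "\<lambda>x. x", simplified] of_nat_times_vec add.assoc)
  qed
  ultimately show "1 \<le> (\<Sum>x\<in>#M. (\<phi>(r := v)) x)"
    by (simp add: MN sum_mset_repeat_mset del: fun_upd_apply) (simp add: sum_mset_repeat_mset)
qed

section \<open>Existence of minimal liftings by Zorn's lemma\<close>

lemma minimal_lifting_exists:
  assumes "lifting f \<psi> \<phi>"
  shows "\<exists>\<pi>. minimal_lifting f \<psi> \<pi> \<and> \<pi> \<le> \<phi>"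
proof -
  define A where "A = {\<pi>. lifting f \<psi> \<pi> \<and> \<pi> \<le> \<phi>}"
  let ?P = "\<lambda>a b :: real ^ 'a \<Rightarrow> real. b \<le> a"
  have "partial_order_on A (relation_of ?P A)"
    by (rule partial_order_on_relation_ofI) auto
  moreover have "\<exists>u\<in>A. \<forall>a\<in>C. ?P a u" if C: "C \<in> Chains (relation_of ?P A)" for C
  proof (cases "C = {}")
    case True
    then show ?thesis using assms by (auto simp: A_def)
  next
    case ne: False
    have CA: "C \<subseteq> A" using C by (auto simp: Chains_def relation_of_def)
    have lin: "a \<le> b \<or> b \<le> a" if "a \<in> C" "b \<in> C" for a b
      using C that by (auto simp: Chains_def relation_of_def)
    have nonneg: "0 \<le> a r" if "a \<in> C" for a r
      using CA that by (auto simp: A_def lifting_def valid_integer_def)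
    \<comment> \<open>The pointwise infimum bounds the chain from below. It stays valid because a
      combination involves finitely many values, and in a totally ordered family a single member
      approximates all of them at once.\<close>
    define u where "u r = (INF a\<in>C. a r)" for r
    have le: "u r \<le> a r" if "a \<in> C" for a r
      unfolding u_def by (rule cINF_lower[OF _ that]) (use nonneg in \<open>auto intro!: bdd_belowI2\<close>)
    have u0: "0 \<le> u r" for r
      unfolding u_def by (rule cINF_greatest[OF ne]) (use nonneg in auto)
    have approx: "\<exists>a\<in>C. (\<Sum>r\<in>#M. a r) \<le> (\<Sum>r\<in>#M. u r) + e * size M" if "e > 0" for e :: real and M
    proof (induction M)
      case empty
      then show ?case using ne by auto
    next
      case (add r M)
      then obtain a where a: "a \<in> C" "(\<Sum>r\<in>#M. a r) \<le> (\<Sum>r\<in>#M. u r) + e * size M" by blast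
      have "\<exists>b\<in>C. b r < u r + e"
        by (rule ccontr)
          (use cINF_greatest[OF ne, of "u r + e" "\<lambda>a. a r"] \<open>e > 0\<close> in \<open>force simp: u_def not_less\<close>)
      then obtain b where b: "b \<in> C" "b r < u r + e" by blast
      obtain c where c: "c \<in> C" "c \<le> a" "c \<le> b" using lin a(1) b(1) by blast
      have "(\<Sum>r\<in>#M. c r) \<le> (\<Sum>r\<in>#M. a r)"
        by (rule sum_mset_mono) (use c in \<open>auto simp: le_fun_def\<close>)
      moreover have "c r \<le> b r" using c by (auto simp: le_fun_def)
      ultimately have "(\<Sum>x\<in>#add_mset r M. c x) \<le> (\<Sum>x\<in>#add_mset r M. u x) + e * size (add_mset r M)"
        using a b by (simp add: algebra_simps)
      then show ?case using c by blast
    qed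
    have "valid_integer f u"
      unfolding valid_integer_mset
    proof (intro conjI allI impI u0)
      fix M assume M: "f + (\<Sum>x\<in>#M. x) \<in> integer_points"
      show "1 \<le> (\<Sum>r\<in>#M. u r)"
      proof (rule field_le_epsilon)
        fix e :: real assume "e > 0"
        \<comment> \<open>The error is at most \<open>e'\<close> per entry of \<open>M\<close>; the
          summand 1 takes care of the empty multiset.\<close>
        define e' where "e' = e / (1 + size M)"
        have "e' > 0" using \<open>e > 0\<close> by (simp add: e'_def add_pos_nonneg)
        then obtain a where a: "a \<in> C" "(\<Sum>r\<in>#M. a r) \<le> (\<Sum>r\<in>#M. u r) + e' * size M"
          using approx[of e' M] by blast
        have "1 \<le> (\<Sum>r\<in>#M. a r)"
          using CA a M by (auto simp: A_def lifting_def valid_integer_mset)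
        moreover have "e' * size M \<le> e"
          using \<open>e > 0\<close> by (simp add: e'_def divide_le_eq add_pos_nonneg algebra_simps)
        ultimately show "1 \<le> (\<Sum>r\<in>#M. u r) + e" using a by linarith
      qed
    qed
    moreover obtain a where "a \<in> C" using ne by blast
    ultimately have "u \<in> A"
      using le[of a] CA by (force simp: A_def lifting_def le_fun_def intro: order_trans)
    then show ?thesis using le by (auto simp: le_fun_def)
  qed
  ultimately obtain m where m: "m \<in> A" "\<And>a. a \<in> A \<Longrightarrow> a \<le> m \<Longrightarrow> a = m"
    using predicate_Zorn[of A ?P] by blast
  then have "minimal_lifting f \<psi> m"
    unfolding minimal_lifting_def A_def by (blast intro: order_trans)
  then show ?thesis using m(1) by (auto simp: A_def)
qed

text \<open>Otherwise \<open>\<pi>(r := v)\<close> would be a strictly smaller lifting. Periodicity,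
  the bound 1 and the symmetry below all rest on this test.\<close>

lemma minimal_lifting_le_update:
  assumes min: "minimal_lifting f \<psi> \<pi>" and v: "0 \<le> v"
    and upd: "\<And>k N. k > 0 \<Longrightarrow> f + real k *\<^sub>R r + (\<Sum>x\<in>#N. x) \<in> integer_points \<Longrightarrow>
        1 \<le> real k * v + (\<Sum>x\<in>#N. \<pi> x)"
  shows "\<pi> r \<le> v"
proof (rule ccontr)
  assume "\<not> \<pi> r \<le> v"
  then have le: "\<pi>(r := v) \<le> \<pi>" and ne: "\<pi>(r := v) \<noteq> \<pi>" by (auto simp: le_fun_def fun_eq_iff)
  have "valid_integer f (\<pi>(r := v))"
    by (rule valid_integer_update) (use min v upd in \<open>auto simp: minimal_lifting_def lifting_def\<close>)
  then have "lifting f \<psi> (\<pi>(r := v))"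
    using min le by (auto simp: minimal_lifting_def lifting_def intro: order_trans)
  then show False using min le ne by (auto simp: minimal_lifting_def)
qed

text \<open>In a feasible combination every copy of \<open>r\<close> can be replaced by a copy of \<open>K\<close>.\<close>

lemma minimal_lifting_le_sum_mset:
  assumes min: "minimal_lifting f \<psi> \<pi>" and K: "(\<Sum>x\<in>#K. x) - r \<in> integer_points"
  shows "\<pi> r \<le> (\<Sum>x\<in>#K. \<pi> x)"
proof (rule minimal_lifting_le_update[OF min])
  have valid: "valid_integer f \<pi>" using min by (simp add: minimal_lifting_def lifting_def)
  have "(\<Sum>x\<in>#K. 0) \<le> (\<Sum>x\<in>#K. \<pi> x)"
    by (rule sum_mset_mono) (rule valid_integer_nonneg[OF valid])
  then show "0 \<le> (\<Sum>x\<in>#K. \<pi> x)" by simp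
  fix k :: nat and N assume N: "f + real k *\<^sub>R r + (\<Sum>x\<in>#N. x) \<in> integer_points"
  have "f + (\<Sum>x\<in>#repeat_mset k K + N. x)
      = (f + real k *\<^sub>R r + (\<Sum>x\<in>#N. x)) + real k *\<^sub>R ((\<Sum>x\<in>#K. x) - r)"
    by (simp add: sum_mset_repeat_mset[of "\<lambda>x. x", simplified] of_nat_times_vec algebra_simps)
  then have "f + (\<Sum>x\<in>#repeat_mset k K + N. x) \<in> integer_points"
    using integer_points_add[OF N integer_points_scale[OF K, of k]] by (simp only:)
  then have "1 \<le> (\<Sum>x\<in>#repeat_mset k K + N. \<pi> x)" by (rule valid_integer_mset_ge[OF valid])
  then show "1 \<le> real k * (\<Sum>x\<in>#K. \<pi> x) + (\<Sum>x\<in>#N. \<pi> x)"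
    by (simp add: sum_mset_repeat_mset)
qed

lemma minimal_lifting_periodic:
  assumes min: "minimal_lifting f \<psi> \<pi>" and w: "w \<in> integer_points"
  shows "\<pi> (r + w) = \<pi> r"
proof (rule antisym)
  show "\<pi> (r + w) \<le> \<pi> r"
    using minimal_lifting_le_sum_mset[OF min, of "{#r#}" "r + w"] integer_points_minus[OF w] by simp
  show "\<pi> r \<le> \<pi> (r + w)"
    using minimal_lifting_le_sum_mset[OF min, of "{#r + w#}" r] w by simp
qed

lemma minimal_lifting_le_1:
  assumes "minimal_lifting f \<psi> \<pi>"
  shows "\<pi> r \<le> 1"
proof (rule minimal_lifting_le_update[OF assms])
  have valid: "valid_integer f \<pi>" using assms by (simp add: minimal_lifting_def lifting_def)
  fix k :: nat and N :: "(real ^ 'a) multiset" assume "k > 0"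
  moreover have "(\<Sum>x\<in>#N. 0) \<le> (\<Sum>x\<in>#N. \<pi> x)"
    by (rule sum_mset_mono) (rule valid_integer_nonneg[OF valid])
  ultimately show "1 \<le> real k * 1 + (\<Sum>x\<in>#N. \<pi> x)" by simp
qed simp

text \<open>If the sum exceeded 1 by \<open>d\<close>, then every feasible combination containing
  \<open>r\<close> would cost at least \<open>1 + d\<close>, since the summands other than one copy
  of \<open>r\<close> represent \<open>- f - r\<close> modulo the lattice. That slack would allow
  \<open>\<pi> r\<close> to be lowered.\<close>

lemma minimal_lifting_symmetric:
  fixes f r :: "real ^ 'n"
  assumes min: "minimal_lifting f \<psi> \<pi>"
  shows "\<pi> r + \<pi> (- f - r) = 1"
proof (rule antisym)
  have valid: "valid_integer f \<pi>" using min by (simp add: minimal_lifting_def lifting_def)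
  note nonneg = valid_integer_nonneg[OF valid]
  show "1 \<le> \<pi> r + \<pi> (- f - r)"
    using valid_integer_mset_ge[OF valid, of "{#r, - f - r#}"] by simp
  show "\<pi> r + \<pi> (- f - r) \<le> 1"
  proof (rule ccontr)
    assume gt: "\<not> ?thesis"
    define d where "d = \<pi> r + \<pi> (- f - r) - 1"
    have d: "d > 0" using gt by (simp add: d_def)
    have p: "\<pi> r > 0" using gt minimal_lifting_le_1[OF min, of "- f - r"] nonneg[of r] by linarith
    \<comment> \<open>The loss is \<open>real k * e\<close>. If
      \<open>real k * \<pi> r \<le> 2\<close>, the second bound keeps the loss below the slack
      \<open>d\<close>; for larger \<open>k\<close>, the first bound leaves half of a cost exceeding
      2.\<close>
    define e where "e = min (\<pi> r / 2) (d * \<pi> r / 2)"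
    have e: "e > 0" "e \<le> \<pi> r / 2" "e \<le> d * \<pi> r / 2" using p d by (auto simp: e_def)
    have "\<pi> r \<le> \<pi> r - e"
    proof (rule minimal_lifting_le_update[OF min])
      show "0 \<le> \<pi> r - e" using e p by simp
      fix k :: nat and N :: "(real ^ 'n) multiset"
      assume k: "k > 0" and N: "f + real k *\<^sub>R r + (\<Sum>x\<in>#N. x) \<in> integer_points"
      have N0: "0 \<le> (\<Sum>x\<in>#N. \<pi> x)"
        using sum_mset_mono[of N "\<lambda>x. 0" \<pi>] nonneg by simp
      have "(\<Sum>x\<in>#repeat_mset (k - 1) {#r#} + N. x) - (- f - r)
          = f + real k *\<^sub>R r + (\<Sum>x\<in>#N. x)"
        using k by (simp add: sum_mset_repeat_mset[of "\<lambda>x. x", simplified] of_nat_times_vec of_nat_diff algebra_simps)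
      then have "\<pi> (- f - r) \<le> (\<Sum>x\<in>#repeat_mset (k - 1) {#r#} + N. \<pi> x)"
        using minimal_lifting_le_sum_mset[OF min] N by metis
      then have u: "\<pi> (- f - r) \<le> (real k - 1) * \<pi> r + (\<Sum>x\<in>#N. \<pi> x)"
        using k by (simp add: sum_mset_repeat_mset of_nat_diff)
      show "1 \<le> real k * (\<pi> r - e) + (\<Sum>x\<in>#N. \<pi> x)"
      proof (cases "real k * \<pi> r \<le> 2")
        case True
        have "real k * e \<le> real k * (d * \<pi> r / 2)" using e(3) by (rule mult_left_mono) simp
        also have "\<dots> = (real k * \<pi> r) * (d / 2)" by simp
        also have "\<dots> \<le> 2 * (d / 2)" using True d by (intro mult_right_mono) auto
        finally show ?thesis using u by (simp add: d_def algebra_simps)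
      next
        case False
        have "real k * (\<pi> r / 2) \<le> real k * (\<pi> r - e)" using e by (intro mult_left_mono) auto
        then show ?thesis using False N0 by simp
      qed
    qed
    then show False using e by simp
  qed
qed

text \<open>What the lifting argument uses of the body \<open>{x. \<psi> (x - f) \<le> 1}\<close>:
  coercivity says that it is bounded, the linear upper bound that \<open>f\<close> is interior, and
  the last assumption that no lattice point is interior.\<close>

locale lattice_gauge =
  fixes f :: "real ^ 'n" and \<psi> :: "real ^ 'n \<Rightarrow> real"
  assumes gauge_add: "\<psi> (x + y) \<le> \<psi> x + \<psi> y"
    and gauge_scale: "0 \<le> t \<Longrightarrow> \<psi> (t *\<^sub>R x) = t * \<psi> x"
    and gauge_coercive: "\<exists>c>0. \<forall>x. c * norm x \<le> \<psi> x"
    and gauge_bounded: "\<exists>C>0. \<forall>x. \<psi> x \<le> C * norm x"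
    and gauge_lattice: "x \<in> integer_points \<Longrightarrow> 1 \<le> \<psi> (x - f)"
begin

text \<open>The set of covered points is \<open>R + \<int>\<^sup>n\<close>, where \<open>R\<close> is the union of
  the regions \<open>{r. \<psi> r + \<psi> (x - f - r) \<le> 1}\<close> over lattice points \<open>x\<close>.\<close>

definition covered :: "real ^ 'n \<Rightarrow> bool" where
  "covered r \<longleftrightarrow>
     (\<exists>w\<in>integer_points. \<exists>w'\<in>integer_points. \<psi> (r + w) + \<psi> (w' - f - r) \<le> 1)"

lemma gauge_nonneg: "0 \<le> \<psi> x"
  by (meson gauge_coercive mult_nonneg_nonneg norm_ge_zero order_trans less_imp_le)

lemma gauge_pos: "x \<noteq> 0 \<Longrightarrow> 0 < \<psi> x"
  by (meson gauge_coercive zero_less_mult_iff zero_less_norm_iff less_le_trans)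

lemma gauge_0: "\<psi> 0 = 0"
  using gauge_scale[of 0 0] by simp

lemma gauge_sum: "finite A \<Longrightarrow> \<psi> (\<Sum>x\<in>A. g x) \<le> (\<Sum>x\<in>A. \<psi> (g x))"
  by (induction A rule: finite_induct) (auto simp: gauge_0 intro: order_trans[OF gauge_add])

lemma gauge_sum_mset: "\<psi> (\<Sum>x\<in>#M. x) \<le> (\<Sum>x\<in>#M. \<psi> x)"
  by (induction M) (auto simp: gauge_0 intro: order_trans[OF gauge_add])

lemma valid_continuous_gauge: "valid_continuous f \<psi>"
  unfolding valid_continuous_def
proof (intro conjI allI impI gauge_nonneg)
  fix s :: "real ^ 'n \<Rightarrow> real"
  assume s: "\<forall>r. 0 \<le> s r" and fin: "finite {r. s r \<noteq> 0}"
    and x: "f + (\<Sum>r | s r \<noteq> 0. s r *\<^sub>R r) \<in> integer_points"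
  have "1 \<le> \<psi> (\<Sum>r | s r \<noteq> 0. s r *\<^sub>R r)" using gauge_lattice[OF x] by simp
  also have "\<dots> \<le> (\<Sum>r | s r \<noteq> 0. \<psi> (s r *\<^sub>R r))" by (rule gauge_sum[OF fin])
  also have "\<dots> = (\<Sum>r | s r \<noteq> 0. \<psi> r * s r)" using s by (simp add: gauge_scale mult.commute)
  finally show "1 \<le> (\<Sum>r | s r \<noteq> 0. \<psi> r * s r)" .
qed

lemma valid_integer_gauge: "valid_integer f \<psi>"
  unfolding valid_integer_mset
proof (intro conjI allI impI gauge_nonneg)
  fix M assume "f + (\<Sum>x\<in>#M. x) \<in> integer_points"
  then have "1 \<le> \<psi> (\<Sum>x\<in>#M. x)" using gauge_lattice by fastforce
  then show "1 \<le> (\<Sum>x\<in>#M. \<psi> x)" using gauge_sum_mset order_trans by blast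
qed

lemma lifting_gauge: "lifting f \<psi> \<psi>"
  by (simp add: lifting_def valid_continuous_gauge valid_integer_gauge)

text \<open>The reflection \<open>r \<mapsto> - f - r\<close> makes the two summands in the
  definition of \<open>covered\<close> change places.\<close>

lemma covered_reflect: "covered (- f - r) \<longleftrightarrow> covered r"
proof -
  have eq: "\<psi> (- f - r + w) = \<psi> (w - f - r)" "\<psi> (w' - f - (- f - r)) = \<psi> (r + w')" for w w'
    by (simp_all add: algebra_simps)
  show ?thesis unfolding covered_def eq by (auto simp: add.commute)
qed

text \<open>By coercivity only finitely many lattice translates of \<open>y\<close> have gauge at
  most \<open>\<psi> y\<close>. An attained minimum turns a failure to be covered into a positive
  margin.\<close>

lemma gauge_inf_attained:
  obtains w where "w \<in> integer_points" "\<And>w'. w' \<in> integer_points \<Longrightarrow> \<psi> (w + y) \<le> \<psi> (w' + y)"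
proof -
  obtain c where c: "c > 0" "\<And>x. c * norm x \<le> \<psi> x" using gauge_coercive by blast
  define W where "W = {w \<in> integer_points. \<psi> (w + y) \<le> \<psi> y}"
  have "norm w \<le> \<psi> y / c + norm y" if "w \<in> W" for w
  proof -
    have "c * norm (w + y) \<le> \<psi> y" using c(2)[of "w + y"] that by (simp add: W_def)
    then have "norm (w + y) \<le> \<psi> y / c" using c(1) by (simp add: field_simps)
    then show ?thesis using norm_triangle_sub[of w "- y"] by simp
  qed
  then have "W \<subseteq> {w \<in> integer_points. norm w \<le> \<psi> y / c + norm y}" by (auto simp: W_def)
  then have fin: "finite W" using finite_integer_points_bounded finite_subset by blast
  have "0 \<in> W" by (simp add: W_def)
  then have ne: "W \<noteq> {}" by blast
  obtain w where w: "w \<in> W" "\<And>w'. w' \<in> W \<Longrightarrow> \<psi> (w + y) \<le> \<psi> (w' + y)"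
    using arg_min_least[OF fin ne, of _ "\<lambda>w. \<psi> (w + y)"] arg_min_if_finite(1)[OF fin ne] by metis
  show thesis
  proof (rule that)
    show "w \<in> integer_points" using w by (simp add: W_def)
    fix w' :: "real ^ 'n" assume "w' \<in> integer_points"
    then show "\<psi> (w + y) \<le> \<psi> (w' + y)" using w by (cases "w' \<in> W") (auto simp: W_def)
  qed
qed

text \<open>At an uncovered \<open>r\<close> the two minimal gauges exceed 1 by some
  \<open>d > 0\<close>. Moving \<open>r\<close> changes each of them by at most \<open>C\<close>
  times the distance, hence the radius \<open>d / (2 * C)\<close>.\<close>

lemma open_uncovered: "open {r. \<not> covered r}"
  unfolding open_dist
proof safe
  fix r assume r: "\<not> covered r"
  obtain C where C: "C > 0" "\<And>x. \<psi> x \<le> C * norm x" using gauge_bounded by blast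
  obtain w where w: "w \<in> integer_points" "\<And>w'. w' \<in> integer_points \<Longrightarrow> \<psi> (w + r) \<le> \<psi> (w' + r)"
    using gauge_inf_attained by blast
  obtain u where u: "u \<in> integer_points"
      "\<And>w'. w' \<in> integer_points \<Longrightarrow> \<psi> (u + (- f - r)) \<le> \<psi> (w' + (- f - r))"
    using gauge_inf_attained by blast
  define d where "d = \<psi> (w + r) + \<psi> (u + (- f - r)) - 1"
  have "d > 0" using r w(1) u(1) unfolding covered_def d_def by (force simp: algebra_simps)
  have "\<not> covered r'" if "dist r' r < d / (2 * C)" for r'
  proof
    assume "covered r'"
    then obtain v v' where v: "v \<in> integer_points" "v' \<in> integer_points"
        "\<psi> (r' + v) + \<psi> (v' - f - r') \<le> 1" by (auto simp: covered_def)
    have "\<psi> (w + r) \<le> \<psi> (v + r)" using w v by blast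
    also have "\<dots> \<le> \<psi> (r' + v) + \<psi> (r - r')"
      using gauge_add[of "r' + v" "r - r'"] by (simp add: algebra_simps)
    finally have 1: "\<psi> (w + r) \<le> \<psi> (r' + v) + \<psi> (r - r')" .
    have "\<psi> (u + (- f - r)) \<le> \<psi> (v' + (- f - r))" using u v by blast
    also have "\<dots> \<le> \<psi> (v' - f - r') + \<psi> (r' - r)"
      using gauge_add[of "v' - f - r'" "r' - r"] by (simp add: algebra_simps)
    finally have 2: "\<psi> (u + (- f - r)) \<le> \<psi> (v' - f - r') + \<psi> (r' - r)" .
    have "\<psi> (r - r') + \<psi> (r' - r) \<le> C * (2 * dist r' r)"
      using C(2)[of "r - r'"] C(2)[of "r' - r"] by (simp add: dist_norm norm_minus_commute)
    also have "\<dots> < d" using that C(1) by (simp add: field_simps)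
    finally show False using 1 2 v(3) by (simp add: d_def)
  qed
  moreover have "d / (2 * C) > 0" using \<open>d > 0\<close> C by simp
  ultimately show "\<exists>e>0. \<forall>y. dist y r < e \<longrightarrow> y \<in> {r. \<not> covered r}" by blast
qed

section \<open>Uniqueness of the minimal lifting and covering\<close>

lemma minimal_lifting_unique_if_covered:
  assumes cov: "\<And>r. covered r"
    and p: "minimal_lifting f \<psi> \<pi>" and q: "minimal_lifting f \<psi> \<pi>'"
  shows "\<pi> = \<pi>'"
proof
  fix r
  obtain w w' where w: "w \<in> integer_points" "w' \<in> integer_points" "\<psi> (r + w) + \<psi> (w' - f - r) \<le> 1"
    using cov unfolding covered_def by blast
  have "\<rho> r = \<psi> (r + w)" if min: "minimal_lifting f \<psi> \<rho>" for \<rho>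
  proof -
    have valid: "valid_integer f \<rho>" and le: "\<And>x. \<rho> x \<le> \<psi> x"
      using min by (auto simp: minimal_lifting_def lifting_def le_fun_def)
    have "f + (\<Sum>x\<in>#{#r + w, w' - f - r#}. x) \<in> integer_points"
      using w integer_points_add by simp
    \<comment> \<open>Validity bounds the sum of the two values below by 1, covering bounds the
      corresponding gauge sum above by 1, so both inequalities \<open>\<rho> \<le> \<psi>\<close>
      are equalities here.\<close>
    then have "1 \<le> \<rho> (r + w) + \<rho> (w' - f - r)"
      using valid_integer_mset_ge[OF valid] by fastforce
    then have "\<rho> (r + w) = \<psi> (r + w)" using le[of "r + w"] le[of "w' - f - r"] w by linarith
    then show ?thesis using minimal_lifting_periodic[OF min w(1)] by simp
  qed
  from this[OF p] this[OF q] show "\<pi> r = \<pi>' r" by simp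
qed

text \<open>Every lifting dominates a minimal one, so the unique minimal lifting lies below all
  liftings. If no such \<open>k\<close> and \<open>w\<close> existed, \<open>\<psi>(r := v)\<close>
  would be a lifting with too small a value at \<open>r\<close>; subadditivity of the gauge lets a
  single vector \<open>w - f - real k *\<^sub>R r\<close> stand for the whole remainder.\<close>

lemma unique_lifting_lower_bound:
  assumes unique: "\<And>\<pi>'. minimal_lifting f \<psi> \<pi>' \<Longrightarrow> \<pi>' = \<pi>"
    and v: "0 \<le> v" "v < \<pi> r"
  obtains k w where "k > 0" "w \<in> integer_points" "real k * v + \<psi> (w - f - real k *\<^sub>R r) < 1"
proof (rule ccontr)
  assume not: "\<not> thesis"
  have below: "\<pi> \<le> \<phi>" if "lifting f \<psi> \<phi>" for \<phi>
    using minimal_lifting_exists[OF that] unique by blast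
  have "valid_integer f (\<psi>(r := v))"
  proof (rule valid_integer_update[OF valid_integer_gauge v(1)])
    fix k :: nat and N :: "(real ^ 'n) multiset"
    assume k: "k > 0" and N: "f + real k *\<^sub>R r + (\<Sum>x\<in>#N. x) \<in> integer_points"
    have "\<not> real k * v + \<psi> (\<Sum>x\<in>#N. x) < 1"
      using not that[OF k N] by (auto simp: algebra_simps)
    then show "1 \<le> real k * v + (\<Sum>x\<in>#N. \<psi> x)" using gauge_sum_mset[of N] by linarith
  qed
  moreover have "\<psi>(r := v) \<le> \<psi>"
    using v below[OF lifting_gauge] by (auto simp: le_fun_def) (smt (verit))
  ultimately have "\<pi> \<le> \<psi>(r := v)"
    by (intro below) (simp add: lifting_def valid_continuous_gauge)
  then have "\<pi> r \<le> (\<psi>(r := v)) r" by (rule le_funD)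
  then show False using v by simp
qed

text \<open>At an uncovered \<open>r\<close> there is slack \<open>d\<close> in
  \<open>\<psi> r + \<psi> (w - f - r) \<ge> 1\<close>, so \<open>\<psi>\<close> could be lowered at
  \<open>r\<close> and the unique minimal lifting would lie strictly below \<open>\<psi> r\<close>.
  The choice of \<open>e\<close> is that of \<open>minimal_lifting_symmetric\<close>.\<close>

lemma unique_lifting_eq_gauge_covered:
  assumes unique: "\<And>\<pi>'. minimal_lifting f \<psi> \<pi>' \<Longrightarrow> \<pi>' = \<pi>"
    and r: "r \<noteq> 0" and eq: "\<pi> r = \<psi> r"
  shows "covered r"
proof (rule ccontr)
  assume not: "\<not> covered r"
  obtain w where w: "w \<in> integer_points"
      "\<And>w'. w' \<in> integer_points \<Longrightarrow> \<psi> (w + (- f - r)) \<le> \<psi> (w' + (- f - r))"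
    using gauge_inf_attained by blast
  define d where "d = \<psi> r + \<psi> (w + (- f - r)) - 1"
  have "\<not> \<psi> (r + 0) + \<psi> (w - f - r) \<le> 1"
    using not w(1) integer_points_0 unfolding covered_def by blast
  then have d: "d > 0" by (simp add: d_def algebra_simps)
  have p: "\<psi> r > 0" using gauge_pos[OF r] .
  define e where "e = min (\<psi> r / 2) (d * \<psi> r / 2)"
  have e: "e > 0" "e \<le> \<psi> r / 2" "e \<le> d * \<psi> r / 2" using p d by (auto simp: e_def)
  obtain k w' where k: "k > 0" "w' \<in> integer_points"
      "real k * (\<psi> r - e) + \<psi> (w' - f - real k *\<^sub>R r) < 1"
    using unique_lifting_lower_bound[OF unique, of "\<psi> r - e" r] e p eq by auto
  have "real k * (\<psi> r / 2) \<le> real k * (\<psi> r - e)" using e by (intro mult_left_mono) auto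
  also have "\<dots> < 1" using k(3) gauge_nonneg[of "w' - f - real k *\<^sub>R r"] by linarith
  finally have k2: "real k * \<psi> r \<le> 2" by simp
  have "real k * e \<le> real k * (d * \<psi> r / 2)" using e(3) by (rule mult_left_mono) simp
  also have "\<dots> = (real k * \<psi> r) * (d / 2)" by simp
  also have "\<dots> \<le> 2 * (d / 2)" using k2 d by (intro mult_right_mono) auto
  finally have ke: "real k * e \<le> d" by simp
  \<comment> \<open>Multiplicity \<open>k\<close> is reduced to 1 by moving the other
    \<open>k - 1\<close> copies of \<open>r\<close> into the remainder.\<close>
  have "\<psi> (w + (- f - r)) \<le> \<psi> (w' + (- f - r))" using w k by blast
  also have "\<dots> = \<psi> (real (k - 1) *\<^sub>R r + (w' - f - real k *\<^sub>R r))"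
    using k(1) by (simp add: of_nat_diff algebra_simps)
  also have "\<dots> \<le> (real k - 1) * \<psi> r + \<psi> (w' - f - real k *\<^sub>R r)"
    using gauge_add[of "real (k - 1) *\<^sub>R r"] k(1) by (simp add: gauge_scale of_nat_diff)
  finally show False using k(3) ke by (simp add: d_def algebra_simps)
qed

text \<open>One of \<open>\<pi> r\<close> and \<open>\<pi> (- f - r)\<close> is at least \<open>1 / 2\<close>, so only the
  multiplicities \<open>k = 1\<close> and \<open>k = 2\<close> occur in the lower bound above.\<close>

lemma unique_lifting_covered_generic:
  assumes min: "minimal_lifting f \<psi> \<pi>"
    and unique: "\<And>\<pi>'. minimal_lifting f \<psi> \<pi>' \<Longrightarrow> \<pi>' = \<pi>"
    and half: "1 / 2 \<le> \<pi> r"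
    and r: "r + f \<notin> integer_points" "2 *\<^sub>R r + f \<notin> integer_points"
  shows "covered r"
proof (rule ccontr)
  assume not: "\<not> covered r"
  have le: "\<pi> x \<le> \<psi> x" for x using min by (auto simp: minimal_lifting_def lifting_def le_fun_def)
  obtain w where w: "w \<in> integer_points"
      "\<And>w'. w' \<in> integer_points \<Longrightarrow> \<psi> (w + (- f - r)) \<le> \<psi> (w' + (- f - r))"
    using gauge_inf_attained by blast
  \<comment> \<open>The lattice translate of \<open>- f - r\<close> with least gauge. It is
    uncovered along with \<open>r\<close>, hence \<open>\<pi> y < \<psi> y\<close>; since
    \<open>\<pi> y = 1 - \<pi> r\<close>, this gives the strict gap \<open>t1\<close>.\<close>
  define y where "y = w + (- f - r)"
  have y0: "y \<noteq> 0" using r(1) w(1) by (auto simp: y_def algebra_simps)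
  have "\<not> covered y"
  proof
    assume "covered y"
    then obtain v v' where v: "v \<in> integer_points" "v' \<in> integer_points"
        "\<psi> (y + v) + \<psi> (v' - f - y) \<le> 1" by (auto simp: covered_def)
    have "\<psi> (r + (v' - w)) + \<psi> ((w + v) - f - r) \<le> 1"
      using v(3) by (simp add: y_def algebra_simps)
    then show False
      using not integer_points_diff[OF v(2) w(1)] integer_points_add[OF w(1) v(1)]
      unfolding covered_def by blast
  qed
  then have "\<pi> y < \<psi> y"
    using unique_lifting_eq_gauge_covered[OF unique y0] le[of y] by fastforce
  moreover have "\<pi> y = \<pi> (- f - r)"
    using minimal_lifting_periodic[OF min w(1), of "- f - r"] by (simp add: y_def add.commute)
  ultimately have t1: "1 - \<pi> r < \<psi> y"
    using minimal_lifting_symmetric[OF min, of r] by simp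
  obtain w2 where w2: "w2 \<in> integer_points"
      "\<And>w'. w' \<in> integer_points \<Longrightarrow> \<psi> (w2 + (- f - 2 *\<^sub>R r)) \<le> \<psi> (w' + (- f - 2 *\<^sub>R r))"
    using gauge_inf_attained by blast
  define t where "t = \<psi> (w2 + (- f - 2 *\<^sub>R r))"
  have "w2 + (- f - 2 *\<^sub>R r) \<noteq> 0" using r(2) w2(1) by (auto simp: algebra_simps)
  then have t: "t > 0" unfolding t_def by (rule gauge_pos)
  \<comment> \<open>Each bound excludes one range of multiplicities: the gap at \<open>y\<close>
    excludes \<open>k = 1\<close>, \<open>t / 2\<close> excludes \<open>k = 2\<close>, and
    \<open>1 / 10\<close> excludes \<open>k \<ge> 3\<close>, because
    \<open>3 * (1 / 2 - 1 / 10) > 1\<close>.\<close>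
  define e where "e = min (1 / 10) (min (\<psi> y + \<pi> r - 1) (t / 2))"
  have e: "e > 0" "e \<le> 1 / 10" "e \<le> \<psi> y + \<pi> r - 1" "e \<le> t / 2"
    using t1 t unfolding e_def by linarith+
  obtain k w' where k: "k > 0" "w' \<in> integer_points"
      "real k * (\<pi> r - e) + \<psi> (w' - f - real k *\<^sub>R r) < 1"
    using unique_lifting_lower_bound[OF unique, of "\<pi> r - e" r] e half by auto
  consider "k = 1" | "k = 2" | "k \<ge> 3" using k(1) by linarith
  then show False
  proof cases
    case 1
    have "\<psi> y \<le> \<psi> (w' + (- f - r))" using w k by (simp add: y_def)
    then show False using k(3) e 1 by (simp add: algebra_simps)
  next
    case 2
    have "t \<le> \<psi> (w' + (- f - 2 *\<^sub>R r))" using w2 k by (simp add: t_def)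
    then show False using k(3) e half 2 by (simp add: algebra_simps)
  next
    case 3
    have "3 * (2 / 5) \<le> real k * (\<pi> r - e)" using 3 e half by (intro mult_mono) auto
    then show False using k(3) gauge_nonneg[of "w' - f - real k *\<^sub>R r"] by linarith
  qed
qed

lemma covered_if_minimal_lifting_unique:
  assumes ex1: "\<exists>!\<pi>. minimal_lifting f \<psi> \<pi>"
  shows "covered r"
proof (rule ccontr)
  assume not: "\<not> covered r"
  obtain \<pi> where min: "minimal_lifting f \<psi> \<pi>"
    and unique: "\<And>\<pi>'. minimal_lifting f \<psi> \<pi>' \<Longrightarrow> \<pi>' = \<pi>" using ex1 by blast
  let ?Z = "integer_points :: (real ^ 'n) set"
  define E where "E = ?Z \<union> (\<lambda>w. w - f) ` ?Z \<union> (\<lambda>w. (1 / 2) *\<^sub>R (w - f)) ` ?Z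
    \<union> (\<lambda>w. (1 / 2) *\<^sub>R (w - f)) ` (\<lambda>w. - w) ` ?Z"
  have "countable E" unfolding E_def using countable_integer_points by auto
  moreover have "uncountable {r. \<not> covered r}"
  proof -
    obtain e where "e > 0" "ball r e \<subseteq> {r. \<not> covered r}"
      using open_uncovered not open_contains_ball by blast
    then show ?thesis using uncountable_ball[of e r] countable_subset by blast
  qed
  ultimately have "\<not> {r. \<not> covered r} \<subseteq> E" using countable_subset by blast
  then obtain s where s: "\<not> covered s" "s \<notin> E" by blast
  \<comment> \<open>These conditions make both \<open>s\<close> and its reflection generic: for
    \<open>- f - s\<close> the two requirements concern \<open>- s\<close> and
    \<open>- (2 *\<^sub>R s + f)\<close>.\<close>
  have Zs: "s + f \<notin> ?Z" "2 *\<^sub>R s + f \<notin> ?Z" "s \<notin> ?Z"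
  proof -
    show "s + f \<notin> ?Z" using s(2) by (force simp: E_def)
    show "s \<notin> ?Z" using s(2) by (force simp: E_def)
    have "2 *\<^sub>R s + f \<in> ?Z \<Longrightarrow> s \<in> (\<lambda>w. (1 / 2) *\<^sub>R (w - f)) ` ?Z"
      by (rule image_eqI[of _ _ "2 *\<^sub>R s + f"]) auto
    then show "2 *\<^sub>R s + f \<notin> ?Z" using s(2) by (auto simp: E_def)
  qed
  show False
  proof (cases "1 / 2 \<le> \<pi> s")
    case True
    then show False using unique_lifting_covered_generic[OF min unique] Zs s(1) by blast
  next
    case False
    then have half: "1 / 2 \<le> \<pi> (- f - s)" using minimal_lifting_symmetric[OF min, of s] by simp
    have 1: "(- f - s) + f \<notin> ?Z" using Zs(3) integer_points_minus[of "- s"] by auto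
    have "- (2 *\<^sub>R (- f - s) + f) = 2 *\<^sub>R s + f"
      by (simp add: algebra_simps scaleR_2)
    then have 2: "2 *\<^sub>R (- f - s) + f \<notin> ?Z" using Zs(2) integer_points_minus by metis
    show False
      using unique_lifting_covered_generic[OF min unique half 1 2] s(1) covered_reflect by blast
  qed
qed

theorem unique_minimal_lifting_iff_covered: "(\<exists>!\<pi>. minimal_lifting f \<psi> \<pi>) \<longleftrightarrow> (\<forall>r. covered r)"
  using minimal_lifting_exists[OF lifting_gauge] minimal_lifting_unique_if_covered
    covered_if_minimal_lifting_unique by blast

end

subsection \<open>Volume of linear images\<close>

text \<open>Row \<open>k\<close> is \<open>v\<close>, so subtracting its multiples turns the rows in
  \<open>J\<close> back into unit vectors; Cramer's rule evaluates what remains.\<close>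

lemma det_replace_row_of_shear:
  fixes u v :: "real ^ 'n"
  assumes "k \<notin> J"
  shows "det (\<chi> i. if i = k then v else if i \<in> J then axis i 1 + u $ i *s v else axis i 1) = v $ k"
proof -
  have "finite J" by simp
  then show ?thesis using assms
  proof (induction J rule: finite_induct)
    case empty
    have v: "(\<Sum>i\<in>UNIV. v $ i *s row i (mat 1 :: real ^ 'n ^ 'n)) = v"
      by (simp add: vec_eq_iff row_def mat_def if_distrib[of "\<lambda>c. x * c" for x] cong: if_cong)
    have row: "row i (mat 1 :: real ^ 'n ^ 'n) = axis i 1" for i
      by (auto simp: vec_eq_iff row_def mat_def axis_def)
    show ?case
      using cramer_lemma_transpose[of k v "mat 1"] unfolding v unfolding row by (simp cong: if_cong)
  next
    case (insert l J)
    let ?B = "\<chi> i. if i = k then v else if i \<in> insert l J then axis i 1 + u $ i *s v else axis i 1"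
    let ?A = "\<chi> i. if i = k then v else if i \<in> J then axis i 1 + u $ i *s v else axis i 1"
    let ?C = "\<chi> i. if i = l then row l ?A + u $ l *s row k ?A else row i ?A"
    have "?B = ?C"
    proof -
      have row: "row i A = A $ i" for i and A :: "real ^ 'n ^ 'n" by (simp add: row_def)
      have "?B $ i = ?C $ i" for i
        unfolding row using insert by (cases "i = l"; cases "i = k") simp_all
      then show ?thesis by (rule iffD2[OF vec_eq_iff, OF allI])
    qed
    then have "det ?B = det ?C" by (rule arg_cong)
    also have "\<dots> = det ?A" by (rule det_row_operation) (use insert in auto)
    also have "\<dots> = v $ k" using insert by blast
    finally show ?case .
  qed
qed

text \<open>The matrix determinant lemma for the identity plus a rank-one matrix. Perturbing the
  rows one at a time, multilinearity adds \<open>u $ k * v $ k\<close> for row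
  \<open>k\<close>.\<close>

lemma det_rank_one_update:
  fixes u v :: "real ^ 'n"
  shows "det (\<chi> i. axis i 1 + u $ i *s v) = 1 + u \<bullet> v"
proof -
  define M where "M J = (\<chi> i. if i \<in> J then axis i 1 + u $ i *s v else axis i 1)" for J
  have "finite J \<Longrightarrow> det (M J) = 1 + (\<Sum>i\<in>J. u $ i * v $ i)" for J
  proof (induction J rule: finite_induct)
    case empty
    have "M {} = mat 1" by (simp add: M_def vec_eq_iff mat_def axis_def)
    then show ?case by simp
  next
    case (insert k J)
    let ?r = "\<lambda>i. if i \<in> J then axis i 1 + u $ i *s v else axis i 1"
    have "det (M (insert k J)) = det (\<chi> i. if i = k then axis k 1 + u $ k *s v else ?r i)"
      by (intro arg_cong[of _ _ det]) (auto simp: M_def vec_eq_iff)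
    also have "\<dots> = det (\<chi> i. if i = k then axis k 1 else ?r i)
        + u $ k * det (\<chi> i. if i = k then v else ?r i)"
      by (simp only: det_row_add det_row_mul)
    also have "(\<chi> i. if i = k then axis k 1 else ?r i) = M J"
      using insert by (auto simp: M_def vec_eq_iff)
    also have "det (\<chi> i. if i = k then v else ?r i) = v $ k"
      using det_replace_row_of_shear insert by blast
    finally show ?case using insert by simp
  qed
  from this[of UNIV] show ?thesis by (simp add: M_def inner_vec_def)
qed

text \<open>Translating by \<open>c\<close> moves the lower corner to \<open>n\<close>-th coordinate
  0, where \<open>measure_shear_interval\<close> applies; the shear takes translates to
  translates.\<close>

lemma measure_shear_cbox:
  fixes a :: "real ^ 'n"
  assumes "m \<noteq> n"
  shows "measure lebesgue ((\<lambda>x. \<chi> i. if i = m then x $ m + x $ n else x $ i) ` cbox a b)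
    = measure lebesgue (cbox a b)" (is "measure lebesgue (?h ` _) = _")
proof (cases "cbox a b = {}")
  case False
  define c where "c = axis n (a $ n)"
  have box: "cbox a b = (+) c ` cbox (a - c) (b - c)"
    by (simp add: cbox_translation[symmetric])
  have "?h ` cbox a b = (+) (?h c) ` ?h ` cbox (a - c) (b - c)"
    unfolding box image_image by (intro image_cong) (auto simp: vec_eq_iff)
  then have "measure lebesgue (?h ` cbox a b) = measure lebesgue (?h ` cbox (a - c) (b - c))"
    by (simp only: measure_translation)
  also have "\<dots> = measure lebesgue (cbox (a - c) (b - c))"
    by (rule measure_shear_interval[OF assms]) (use False in \<open>auto simp: box c_def\<close>)
  also have "\<dots> = measure lebesgue (cbox a b)"
    by (simp only: box measure_translation)
  finally show ?thesis .
qed simp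

text \<open>The library states \<open>measure_linear_image\<close> only for well-ordered index types.\<close>

lemma measure_linear_image_cart:
  fixes f :: "real ^ 'n \<Rightarrow> real ^ 'n"
  assumes "linear f" "S \<in> lmeasurable"
  shows "f ` S \<in> lmeasurable \<and> measure lebesgue (f ` S) = \<bar>det (matrix f)\<bar> * measure lebesgue S"
proof -
  let ?P = "\<lambda>f :: real ^ 'n \<Rightarrow> real ^ 'n. \<forall>S\<in>lmeasurable. f ` S \<in> lmeasurable \<and>
    measure lebesgue (f ` S) = \<bar>det (matrix f)\<bar> * measure lebesgue S"
  have "?P f"
  proof (rule induct_linear_elementary[OF assms(1)])
    fix g h :: "real ^ 'n \<Rightarrow> real ^ 'n"
    assume "linear g" "linear h" "?P g" "?P h"
    then have "?P (\<lambda>x. g (h x))"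
      by (simp add: image_image[symmetric] matrix_compose[unfolded o_def] det_mul abs_mult)
    then show "?P (g \<circ> h)" by (simp only: o_def)
  next
    fix g :: "real ^ 'n \<Rightarrow> real ^ 'n" and i
    assume g: "linear g" "\<And>x. g x $ i = 0"
    have "axis i 1 \<noteq> g x" for x
    proof
      assume "axis i 1 = g x"
      then have "axis i 1 $ i = g x $ i" by (rule arg_cong)
      then show False by (simp add: g(2))
    qed
    then have "axis i 1 \<notin> range g" by blast
    then have "\<not> inj g" using linear_injective_imp_surjective[OF g(1)] by blast
    then show "?P g"
      using negligible_linear_singular_image[OF g(1)] det_nz_iff_inj[OF g(1)]
      by (auto simp: negligible_iff_measure)
  next
    fix c :: "'n \<Rightarrow> real"
    have "matrix (\<lambda>x. \<chi> i. c i * x $ i) = (\<chi> i j. if i = j then c i else 0)"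
      by (auto simp: matrix_def vec_eq_iff axis_def)
    then have "det (matrix (\<lambda>x. \<chi> i. c i * x $ i)) = prod c UNIV"
      by (simp add: det_diagonal)
    then show "?P (\<lambda>x. \<chi> i. c i * x $ i)"
      by (simp add: measurable_stretch measure_stretch)
  next
    fix m n :: 'n assume "m \<noteq> n"
    let ?t = "Transposition.transpose m n"
    let ?h = "\<lambda>x :: real ^ 'n. \<chi> i. x $ ?t i"
    have lin: "linear ?h" by (rule linearI) (simp_all add: vec_eq_iff)
    have inv: "?h (?h x) = x" for x by (simp add: vec_eq_iff)
    have "matrix ?h = (\<chi> i. mat 1 $ ?t i)"
      by (auto simp: matrix_def vec_eq_iff mat_def axis_def)
    then have "det (matrix ?h) = of_int (sign ?t) * det (mat 1 :: real ^ 'n ^ 'n)"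
      by (simp only: det_permute_rows[OF permutes_swap_id[of m UNIV n, simplified]])
    then have det: "\<bar>det (matrix ?h)\<bar> = 1"
      by (auto simp: sign_swap_id)
    have meq: "measure lebesgue (?h ` cbox a b) = 1 * measure lebesgue (cbox a b)" for a b
    proof -
      have "?h ` cbox a b = cbox (?h a) (?h b)"
      proof
        show "?h ` cbox a b \<subseteq> cbox (?h a) (?h b)" by (auto simp: mem_box_cart)
        show "cbox (?h a) (?h b) \<subseteq> ?h ` cbox a b"
        proof
          fix x assume x: "x \<in> cbox (?h a) (?h b)"
          have "a $ i \<le> ?h x $ i \<and> ?h x $ i \<le> b $ i" for i
            using x by (simp add: mem_box_cart) (metis transpose_involutory)
          then have "?h x \<in> cbox a b" by (simp add: mem_box_cart)
          then show "x \<in> ?h ` cbox a b" using inv by (intro image_eqI[of _ _ "?h x"]) auto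
        qed
      qed
      moreover have "measure lebesgue (cbox (?h a) (?h b)) = measure lebesgue (cbox a b)"
      proof -
        have "(\<forall>i. ?h a $ i \<le> ?h b $ i) \<longleftrightarrow> (\<forall>i. a $ i \<le> b $ i)"
          by simp (metis transpose_involutory)
        moreover have "(\<Prod>i\<in>UNIV. b $ ?t i - a $ ?t i) = (\<Prod>i\<in>UNIV. b $ i - a $ i)"
          using prod.permute[OF permutes_swap_id[of m UNIV n, simplified], of "\<lambda>i. b $ i - a $ i"]
          by (simp add: o_def)
        ultimately show ?thesis by (simp add: content_cbox_if_cart interval_ne_empty_cart interval_eq_empty_cart not_le[symmetric])
      qed
      ultimately show ?thesis by simp
    qed
    show "?P ?h"
    proof
      fix S :: "(real ^ 'n) set" assume S: "S \<in> lmeasurable"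
      show "?h ` S \<in> lmeasurable \<and> measure lebesgue (?h ` S) = \<bar>det (matrix ?h)\<bar> * measure lebesgue S"
        using measure_linear_sufficient[OF lin S meq] unfolding det by simp
    qed
  next
    fix m n :: 'n assume mn: "m \<noteq> n"
    let ?h = "\<lambda>x :: real ^ 'n. \<chi> i. if i = m then x $ m + x $ n else x $ i"
    have lin: "linear ?h" by (rule linearI) (auto simp: vec_eq_iff algebra_simps)
    have "matrix ?h = (\<chi> i. axis i 1 + axis m 1 $ i *s axis n 1)"
    proof -
      have "matrix ?h $ i $ j = (if i = m then axis j 1 $ m + axis j 1 $ n else axis j 1 $ i)" for i j
        by (simp add: matrix_def)
      moreover have "(if i = m then axis j 1 $ m + axis j 1 $ n else axis j 1 $ i) = (axis i 1 $ j + axis m 1 $ i * axis n 1 $ j :: real)" for i j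
        by (simp add: axis_def)
      ultimately show ?thesis by (simp add: vec_eq_iff)
    qed
    then have "det (matrix ?h) = 1"
      using mn by (simp add: det_rank_one_update inner_axis_axis)
    then have det: "\<bar>det (matrix ?h)\<bar> = 1" by simp
    have meq: "measure lebesgue (?h ` cbox a b) = 1 * measure lebesgue (cbox a b)" for a b
      by (simp only: measure_shear_cbox[OF mn] mult_1)
    show "?P ?h"
    proof
      fix S :: "(real ^ 'n) set" assume S: "S \<in> lmeasurable"
      show "?h ` S \<in> lmeasurable \<and> measure lebesgue (?h ` S) = \<bar>det (matrix ?h)\<bar> * measure lebesgue S"
        using measure_linear_sufficient[OF lin S meq] unfolding det by simp
    qed
  qed
  then show ?thesis using assms(2) by blast
qed

lemma measure_rank_one_update:
  fixes a e :: "real ^ 'n"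
  assumes "S \<in> lmeasurable" "0 \<le> 1 + a \<bullet> e"
  shows "(\<lambda>r. r + (a \<bullet> r) *\<^sub>R e) ` S \<in> lmeasurable"
    and "measure lebesgue ((\<lambda>r. r + (a \<bullet> r) *\<^sub>R e) ` S) = (1 + a \<bullet> e) * measure lebesgue S"
proof -
  let ?T = "\<lambda>r. r + (a \<bullet> r) *\<^sub>R e"
  have lin: "linear ?T" by (rule linearI) (auto simp: algebra_simps inner_add_right)
  have "matrix ?T = (\<chi> i. axis i 1 + e $ i *s a)"
  proof -
    have "matrix ?T $ i $ j = axis j 1 $ i + a $ j * e $ i" for i j
      by (simp add: matrix_def inner_axis)
    moreover have "axis j 1 $ i = (axis i 1 :: real ^ 'n) $ j" for i j
      by (simp add: axis_def)
    ultimately show ?thesis by (simp add: vec_eq_iff)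
  qed
  then have "det (matrix ?T) = 1 + a \<bullet> e" by (simp add: det_rank_one_update inner_commute)
  then show "?T ` S \<in> lmeasurable" "measure lebesgue (?T ` S) = (1 + a \<bullet> e) * measure lebesgue S"
    using measure_linear_image_cart[OF lin assms(1)] assms(2) by auto
qed

subsection \<open>Volume modulo the integer lattice\<close>

text \<open>Half-open, so that every coset of the lattice has exactly one representative.\<close>

definition unit_cell :: "(real ^ 'n) set" where
  "unit_cell = {x. \<forall>i. 0 \<le> x $ i \<and> x $ i < 1}"

text \<open>Injectivity of the projection to the torus. It allows volumes in the torus to be
  computed with sets of vectors, without forming the quotient.\<close>

definition lattice_injective :: "(real ^ 'n) set \<Rightarrow> bool" where
  "lattice_injective S \<longleftrightarrow> (\<forall>r\<in>S. \<forall>r'\<in>S. r - r' \<in> integer_points \<longrightarrow> r = r')"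

lemma unit_cell_measurable: "unit_cell \<in> sets lebesgue"
proof -
  have eq: "(unit_cell :: (real ^ 'n) set) = (\<Inter>i. {x. 0 \<le> x $ i} \<inter> {x. x $ i < 1})"
    by (auto simp: unit_cell_def)
  have "{x :: real ^ 'n. 0 \<le> x $ i} \<in> sets borel" "{x :: real ^ 'n. x $ i < 1} \<in> sets borel" for i
    by (intro borel_closed borel_open closed_Collect_le open_Collect_less continuous_intros)+
  then have "(\<Inter>i. {x :: real ^ 'n. 0 \<le> x $ i} \<inter> {x. x $ i < 1}) \<in> sets borel"
    by (intro sets.finite_INT sets.Int) auto
  then have "(unit_cell :: (real ^ 'n) set) \<in> sets lborel" by (simp only: eq sets_lborel)
  then show ?thesis by (rule sets_completionI_sets)
qed

lemma emeasure_unit_cell: "emeasure lebesgue (unit_cell :: (real ^ 'n) set) = 1"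
proof -
  have One: "(\<Prod>b\<in>Basis. (1 :: real ^ 'n) \<bullet> b) = 1"
    by (intro prod.neutral) (auto simp: Basis_vec_def inner_axis)
  have le: "0 \<bullet> b \<le> (1 :: real ^ 'n) \<bullet> b" if "b \<in> Basis" for b
    using that by (auto simp: Basis_vec_def inner_axis)
  have "emeasure lebesgue (box 0 1 :: (real ^ 'n) set) \<le> emeasure lebesgue (unit_cell :: (real ^ 'n) set)"
    by (intro emeasure_mono unit_cell_measurable)
      (auto simp: unit_cell_def mem_box_cart less_imp_le)
  moreover have "emeasure lebesgue (unit_cell :: (real ^ 'n) set) \<le> emeasure lebesgue (cbox 0 1 :: (real ^ 'n) set)"
    by (intro emeasure_mono) (auto simp: unit_cell_def mem_box_cart less_imp_le)
  ultimately show ?thesis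
    using emeasure_lborel_box[OF le] emeasure_lborel_cbox[OF le] by (simp add: One)
qed

lemma unit_cell_representative:
  obtains w where "w \<in> integer_points" "x - w \<in> unit_cell"
proof
  show "(\<chi> i. of_int \<lfloor>x $ i\<rfloor>) \<in> integer_points" by (simp add: integer_points_def)
  show "x - (\<chi> i. of_int \<lfloor>x $ i\<rfloor>) \<in> unit_cell"
    by (auto simp: unit_cell_def) linarith+
qed

lemma unit_cell_lattice_injective: "lattice_injective unit_cell"
  unfolding lattice_injective_def
proof (intro ballI impI)
  fix x y :: "real ^ 'n"
  assume x: "x \<in> unit_cell" and y: "y \<in> unit_cell" and "x - y \<in> integer_points"
  have "x $ i = y $ i" for i
  proof -
    obtain k :: int where k: "x $ i - y $ i = of_int k"
      using \<open>x - y \<in> integer_points\<close> by (auto simp: integer_points_def Ints_def)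
    moreover have "0 \<le> x $ i" "x $ i < 1" "0 \<le> y $ i" "y $ i < 1"
      using x y by (auto simp: unit_cell_def)
    ultimately have "k = 0" by linarith
    then show ?thesis using k by simp
  qed
  then show "x = y" by (simp add: vec_eq_iff)
qed

text \<open>\<open>S\<close> is cut along the translates of the unit cell and each piece is moved
  back into the cell; injectivity keeps the moved pieces disjoint. Their union is the image of
  \<open>S\<close> in the torus.\<close>

lemma emeasure_lattice_injective:
  assumes S: "S \<in> sets lebesgue" and inj: "lattice_injective S"
  shows "{y \<in> unit_cell. \<exists>w\<in>integer_points. w + y \<in> S} \<in> sets lebesgue"
    and "emeasure lebesgue S = emeasure lebesgue {y \<in> unit_cell. \<exists>w\<in>integer_points. w + y \<in> S}"
proof -
  let ?Z = "integer_points :: (real ^ 'a) set"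
  define X where "X w = S \<inter> (+) w ` unit_cell" for w
  define Y where "Y w = (+) (- w) ` X w" for w
  have X: "X w \<in> sets lebesgue" for w
    unfolding X_def by (intro sets.Int S lebesgue_sets_translation unit_cell_measurable)
  have Y: "Y w \<in> sets lebesgue" for w
    unfolding Y_def by (intro lebesgue_sets_translation X)
  have memY: "y \<in> Y w \<longleftrightarrow> y \<in> unit_cell \<and> w + y \<in> S" for y w
    by (auto simp: Y_def X_def image_iff algebra_simps)
  have S_eq: "S = (\<Union>w\<in>?Z. X w)"
  proof
    show "S \<subseteq> (\<Union>w\<in>?Z. X w)"
    proof
      fix x assume "x \<in> S"
      moreover obtain w where "w \<in> ?Z" "x - w \<in> unit_cell" by (rule unit_cell_representative)
      ultimately show "x \<in> (\<Union>w\<in>?Z. X w)"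
        by (auto simp: X_def intro!: bexI[of _ w] image_eqI[of _ _ "x - w"])
    qed
  qed (auto simp: X_def)
  have disjX: "disjoint_family_on X ?Z"
    unfolding disjoint_family_on_def
  proof (intro ballI impI, rule ccontr)
    fix v w assume vw: "v \<in> ?Z" "w \<in> ?Z" "v \<noteq> w" and "X v \<inter> X w \<noteq> {}"
    then obtain p q where pq: "p \<in> unit_cell" "q \<in> unit_cell" "v + p = w + q"
      by (auto simp: X_def)
    then have "p - q = w - v" by (simp add: algebra_simps)
    then have "p = q"
      using unit_cell_lattice_injective pq vw integer_points_diff unfolding lattice_injective_def by metis
    then show False using pq vw by simp
  qed
  have disjY: "disjoint_family_on Y ?Z"
    unfolding disjoint_family_on_def
  proof (intro ballI impI, rule ccontr)
    fix v w assume vw: "v \<in> ?Z" "w \<in> ?Z" "v \<noteq> w" and "Y v \<inter> Y w \<noteq> {}"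
    then obtain y where y: "v + y \<in> S" "w + y \<in> S" by (auto simp: memY)
    have "(v + y) - (w + y) = v - w" by simp
    then have "v + y = w + y"
      using inj y integer_points_diff[OF vw(1,2)] unfolding lattice_injective_def by metis
    then show False using vw by simp
  qed
  have UY: "(\<Union>w\<in>?Z. Y w) = {y \<in> unit_cell. \<exists>w\<in>?Z. w + y \<in> S}" by (auto simp: memY)
  have "(\<Union>w\<in>?Z. Y w) \<in> sets lebesgue"
    by (intro sets.countable_UN' countable_integer_points) (use Y in auto)
  then show "{y \<in> unit_cell. \<exists>w\<in>integer_points. w + y \<in> S} \<in> sets lebesgue" by (simp add: UY)
  have "emeasure lebesgue S = emeasure lebesgue (\<Union>w\<in>?Z. X w)" using S_eq by simp
  also have "\<dots> = (\<integral>\<^sup>+w. emeasure lebesgue (X w) \<partial>count_space ?Z)"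
    by (intro emeasure_UN_countable X countable_integer_points disjX)
  also have "\<dots> = (\<integral>\<^sup>+w. emeasure lebesgue (Y w) \<partial>count_space ?Z)"
    using emeasure_lebesgue_affine[of 1 "- w" "X w" for w]
    by (intro nn_integral_cong) (simp add: Y_def)
  also have "\<dots> = emeasure lebesgue (\<Union>w\<in>?Z. Y w)"
    by (intro emeasure_UN_countable[symmetric] Y countable_integer_points disjY)
  finally show "emeasure lebesgue S = emeasure lebesgue {y \<in> unit_cell. \<exists>w\<in>integer_points. w + y \<in> S}"
    by (simp only: UY)
qed

lemma emeasure_lattice_injective_le_1:
  assumes "S \<in> sets lebesgue" "lattice_injective S"
  shows "emeasure lebesgue S \<le> 1"
proof -
  have "emeasure lebesgue {y \<in> unit_cell. \<exists>w\<in>integer_points. w + y \<in> S}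
      \<le> emeasure lebesgue (unit_cell :: (real ^ 'a) set)"
    by (intro emeasure_mono unit_cell_measurable) auto
  then show ?thesis by (simp add: emeasure_lattice_injective(2)[OF assms] emeasure_unit_cell)
qed

text \<open>Adding a small ball that avoids all translates of \<open>S\<close> keeps the set injective
  modulo the lattice.\<close>

lemma lattice_injective_meets_open:
  fixes U :: "(real ^ 'n) set"
  assumes S: "S \<in> sets lebesgue" "lattice_injective S" "emeasure lebesgue S = 1"
    and U: "open U" "U \<noteq> {}"
  shows "\<exists>y\<in>U. \<exists>w\<in>integer_points. w + y \<in> S"
proof (rule ccontr)
  assume avoid: "\<not> ?thesis"
  obtain p e where e: "e > 0" "ball p e \<subseteq> U"
    using U by (metis ex_in_conv open_contains_ball)
  \<comment> \<open>With radius at most \<open>1 / 2\<close>, two points of the ball differ by less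
    than 1 in norm and are congruent only if equal.\<close>
  define V where "V = ball p (min e (1 / 2))"
  have VU: "V \<subseteq> U" using e by (auto simp: V_def)
  have smallZ: "w = 0" if "w \<in> integer_points" "norm w < 1" for w :: "real ^ 'n"
  proof -
    have "w $ i = 0" for i
    proof -
      have "w $ i \<in> \<int>" using that by (simp add: integer_points_def)
      then obtain k :: int where k: "w $ i = of_int k" by (elim Ints_cases)
      then have "\<bar>of_int k :: real\<bar> < 1" using component_le_norm_cart[of w i] that by simp
      then show ?thesis using k by simp
    qed
    then show ?thesis by (simp add: vec_eq_iff)
  qed
  have injV: "x = y" if "x \<in> V" "y \<in> V" "x - y \<in> integer_points" for x y
  proof -
    have "norm (x - y) < 1"
      using that dist_triangle_half_l[of x p 1 y] by (auto simp: V_def dist_norm norm_minus_commute)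
    then show ?thesis using smallZ[OF that(3)] by simp
  qed
  have cross: "x - y \<notin> integer_points" "y - x \<notin> integer_points" if "x \<in> S" "y \<in> V" for x y
  proof -
    show "x - y \<notin> integer_points" using avoid VU that by (metis diff_add_cancel subsetD)
    then show "y - x \<notin> integer_points" using integer_points_minus[of "y - x"] by auto
  qed
  have "lattice_injective (S \<union> V)"
    using S(2) injV cross unfolding lattice_injective_def by blast
  then have "emeasure lebesgue (S \<union> V) \<le> 1"
    using S(1) by (intro emeasure_lattice_injective_le_1) (auto simp: V_def)
  moreover have "S \<inter> V = {}" using cross(1) integer_points_0 by force
  then have "emeasure lebesgue (S \<union> V) = 1 + emeasure lebesgue V"
    using S by (subst plus_emeasure[symmetric]) (auto simp: V_def)
  moreover have "emeasure lebesgue V = ennreal (measure lebesgue V)"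
    by (intro emeasure_eq_measure2) (simp add: V_def)
  ultimately have "ennreal (1 + measure lebesgue V) \<le> ennreal 1"
    by (simp add: ennreal_plus)
  then have "measure lebesgue V \<le> 0" by (subst (asm) ennreal_le_iff) auto
  moreover have "0 < measure lborel V"
    unfolding V_def using e(1) by (intro content_ball_pos) auto
  moreover have "measure lebesgue V = measure lborel V" by (simp add: V_def)
  ultimately show False by linarith
qed

text \<open>A measurable choice: along an enumeration of the lattice, each point of the unit cell
  takes the first lattice vector that carries it into \<open>S\<close>. The set \<open>T k\<close>
  collects the points obtained with the \<open>k\<close>-th vector.\<close>

lemma lattice_injective_representatives:
  fixes S N :: "(real ^ 'n) set"
  assumes S: "S \<in> sets lebesgue" and N: "negligible N"
    and cover: "\<And>y. y \<notin> N \<Longrightarrow> \<exists>w\<in>integer_points. w + y \<in> S"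
  obtains S0 where "S0 \<subseteq> S" "S0 \<in> sets lebesgue" "lattice_injective S0" "emeasure lebesgue S0 = 1"
proof
  let ?Z = "integer_points :: (real ^ 'n) set"
  define e where "e = from_nat_into ?Z"
  have Zne: "?Z \<noteq> {}" using integer_points_0 by blast
  have eZ: "e k \<in> ?Z" for k unfolding e_def by (rule from_nat_into[OF Zne])
  have esurj: "\<exists>k. w = e k" if "w \<in> ?Z" for w
    using range_from_nat_into[OF Zne countable_integer_points] that by (auto simp: e_def)
  define T where "T k = (S \<inter> (+) (e k) ` unit_cell) - (\<Union>j<k. (+) (e k - e j) ` S)" for k
  define S0 where "S0 = (\<Union>k. T k)"
  have memT: "z \<in> T k \<longleftrightarrow> z \<in> S \<and> z - e k \<in> unit_cell \<and> (\<forall>j<k. e j + (z - e k) \<notin> S)" for z k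
  proof -
    have "z \<in> (+) (e k) ` unit_cell \<longleftrightarrow> z - e k \<in> unit_cell"
      by (auto intro: image_eqI[of _ _ "z - e k"])
    moreover have "z \<in> (+) (e k - e j) ` S \<longleftrightarrow> e j + (z - e k) \<in> S" for j
      by (auto intro!: image_eqI[of _ _ "e j + (z - e k)"])
    ultimately show ?thesis by (auto simp: T_def)
  qed
  show "S0 \<subseteq> S" by (auto simp: S0_def T_def)
  show measS0: "S0 \<in> sets lebesgue"
    unfolding S0_def T_def using S
    by (intro sets.countable_UN image_subsetI sets.Diff sets.Int sets.finite_UN
        lebesgue_sets_translation unit_cell_measurable; simp)
  show inj: "lattice_injective S0"
    unfolding lattice_injective_def
  proof (intro ballI impI)
    fix z z' assume "z \<in> S0" "z' \<in> S0" and zz: "z - z' \<in> ?Z"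
    then obtain k k' where k: "z \<in> T k" "z' \<in> T k'" by (auto simp: S0_def)
    have "(z - e k) - (z' - e k') = (z - z') + (e k' - e k)" by simp
    then have "(z - e k) - (z' - e k') \<in> ?Z"
      using zz eZ integer_points_add integer_points_diff by metis
    then have eq: "z - e k = z' - e k'"
      using unit_cell_lattice_injective k unfolding lattice_injective_def memT by blast
    have "e k' + (z - e k) = z'" "e k + (z' - e k') = z" using eq by (simp_all add: algebra_simps)
    then have "\<not> k < k'" "\<not> k' < k" using k by (auto simp: memT)
    then have "k = k'" by simp
    then show "z = z'" using eq by simp
  qed
  have "unit_cell - N \<subseteq> {y \<in> unit_cell. \<exists>w\<in>?Z. w + y \<in> S0}"
  proof
    fix y assume y: "y \<in> unit_cell - N"
    then have "\<exists>k. e k + y \<in> S" using cover esurj by blast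
    then obtain k where k: "e k + y \<in> S" "\<And>j. j < k \<Longrightarrow> e j + y \<notin> S"
      using exists_least_iff[of "\<lambda>k. e k + y \<in> S"] by blast
    then have "e k + y \<in> T k" using y by (auto simp: memT)
    then show "y \<in> {y \<in> unit_cell. \<exists>w\<in>?Z. w + y \<in> S0}" using y eZ by (auto simp: S0_def)
  qed
  then have "emeasure lebesgue (unit_cell - N) \<le> emeasure lebesgue {y \<in> unit_cell. \<exists>w\<in>?Z. w + y \<in> S0}"
    by (intro emeasure_mono emeasure_lattice_injective(1)[OF measS0 inj])
  moreover have "emeasure lebesgue (unit_cell - N) = 1"
    using N emeasure_Diff_null_set[of N lebesgue unit_cell]
    by (simp add: negligible_iff_null_sets unit_cell_measurable emeasure_unit_cell)
  ultimately have "1 \<le> emeasure lebesgue S0"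
    by (simp add: emeasure_lattice_injective(2)[OF measS0 inj])
  then show "emeasure lebesgue S0 = 1"
    using emeasure_lattice_injective_le_1[OF measS0 inj] by simp
qed

lemma open_lebesgue: "open S \<Longrightarrow> S \<in> sets lebesgue"
  by (intro sets_completionI_sets) simp

subsection \<open>Independence of the interior point\<close>

text \<open>The interior of the cone over facet \<open>i\<close>, on which the gauge is the linear
  function given by \<open>\<alpha> i\<close>. The normals form an indexed family so that those for
  another interior point keep the same index set.\<close>

definition strict_cone :: "('i \<Rightarrow> real ^ 'n) \<Rightarrow> 'i set \<Rightarrow> 'i \<Rightarrow> (real ^ 'n) set" where
  "strict_cone \<alpha> I i = {r. \<forall>j\<in>I - {i}. \<alpha> j \<bullet> r < \<alpha> i \<bullet> r}"

text \<open>The part of \<open>R\<close> contributed by the lattice points of facet \<open>i\<close>, without its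
  boundary, which is a null set.\<close>

definition spindles :: "('i \<Rightarrow> real ^ 'n) \<Rightarrow> 'i set \<Rightarrow> real ^ 'n \<Rightarrow> 'i \<Rightarrow> (real ^ 'n) set" where
  "spindles \<alpha> I f i = {r \<in> strict_cone \<alpha> I i.
     \<exists>x\<in>integer_points. \<alpha> i \<bullet> (x - f) = 1 \<and> x - f - r \<in> strict_cone \<alpha> I i}"

lemma strict_cone_le: "r \<in> strict_cone \<alpha> I i \<Longrightarrow> j \<in> I \<Longrightarrow> \<alpha> j \<bullet> r \<le> \<alpha> i \<bullet> r"
  by (cases "j = i") (auto simp: strict_cone_def less_imp_le)

lemma strict_cone_ge_imp_eq:
  "r \<in> strict_cone \<alpha> I i \<Longrightarrow> j \<in> I \<Longrightarrow> \<alpha> i \<bullet> r \<le> \<alpha> j \<bullet> r \<Longrightarrow> j = i"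
  by (cases "j = i") (auto simp: strict_cone_def not_less[symmetric])

lemma open_strict_cone: "finite I \<Longrightarrow> open (strict_cone \<alpha> I i)"
proof -
  assume "finite I"
  then have "open (\<Inter>j\<in>I - {i}. {r. \<alpha> j \<bullet> r < \<alpha> i \<bullet> r})"
    by (intro open_INT ballI open_Collect_less continuous_intros) auto
  moreover have "(\<Inter>j\<in>I - {i}. {r. \<alpha> j \<bullet> r < \<alpha> i \<bullet> r}) = strict_cone \<alpha> I i"
    by (auto simp: strict_cone_def)
  ultimately show ?thesis by simp
qed

lemma open_spindles:
  assumes "finite I"
  shows "open (spindles \<alpha> I f i)"
proof -
  have "spindles \<alpha> I f i = (\<Union>x\<in>{x \<in> integer_points. \<alpha> i \<bullet> (x - f) = 1}.
      strict_cone \<alpha> I i \<inter> (\<lambda>r. x - f - r) -` strict_cone \<alpha> I i)"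
    by (auto simp: spindles_def)
  moreover have "open ((\<lambda>r. x - f - r) -` strict_cone \<alpha> I i)" for x
    by (rule open_vimage[OF open_strict_cone[OF assms]]) (intro continuous_intros)
  ultimately show ?thesis
    by (simp only:) (intro open_UN ballI open_Int open_strict_cone assms)
qed

text \<open>An exchange argument: with \<open>x - f = p + u\<close> and
  \<open>y - f = q + v\<close>, also \<open>f + p + v\<close> and \<open>f + q + u\<close> are
  lattice points, so some \<open>\<alpha> k\<close> and \<open>\<alpha> l\<close> are at least 1 on
  \<open>p + v\<close> and \<open>q + u\<close>.\<close>

lemma spindles_collision:
  assumes free: "\<And>x. x \<in> integer_points \<Longrightarrow> \<exists>k\<in>I. 1 \<le> \<alpha> k \<bullet> (x - f)"
    and p: "p \<in> spindles \<alpha> I f i" and q: "q \<in> spindles \<alpha> I f j"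
    and pq: "p - q \<in> integer_points"
  shows "i = j \<and> \<alpha> i \<bullet> p = \<alpha> i \<bullet> q"
proof -
  obtain x where x: "x \<in> integer_points" "\<alpha> i \<bullet> (x - f) = 1" "x - f - p \<in> strict_cone \<alpha> I i"
    and p': "p \<in> strict_cone \<alpha> I i" using p by (auto simp: spindles_def)
  obtain y where y: "y \<in> integer_points" "\<alpha> j \<bullet> (y - f) = 1" "y - f - q \<in> strict_cone \<alpha> I j"
    and q': "q \<in> strict_cone \<alpha> I j" using q by (auto simp: spindles_def)
  define u where "u = x - f - p"
  define v where "v = y - f - q"
  have up: "\<alpha> i \<bullet> u + \<alpha> i \<bullet> p = 1"
    using x(2) by (simp add: u_def inner_diff_right)
  have vq: "\<alpha> j \<bullet> v + \<alpha> j \<bullet> q = 1"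
    using y(2) by (simp add: v_def inner_diff_right)
  obtain k where k: "k \<in> I" "1 \<le> \<alpha> k \<bullet> (y + (p - q) - f)"
    using free integer_points_add[OF y(1) pq] by blast
  obtain l where l: "l \<in> I" "1 \<le> \<alpha> l \<bullet> (x - (p - q) - f)"
    using free integer_points_diff[OF x(1) pq] by blast
  have kpv: "1 \<le> \<alpha> k \<bullet> p + \<alpha> k \<bullet> v"
    using k(2) by (simp add: v_def inner_diff_right inner_add_right)
  have luq: "1 \<le> \<alpha> l \<bullet> u + \<alpha> l \<bullet> q"
    using l(2) by (simp add: u_def inner_diff_right inner_add_right)
  have le: "\<alpha> k \<bullet> p \<le> \<alpha> i \<bullet> p" "\<alpha> k \<bullet> v \<le> \<alpha> j \<bullet> v" "\<alpha> l \<bullet> u \<le> \<alpha> i \<bullet> u" "\<alpha> l \<bullet> q \<le> \<alpha> j \<bullet> q"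
    using strict_cone_le k(1) l(1) p' q' x(3) y(3) by (auto simp: u_def v_def)
  \<comment> \<open>The upper bounds \<open>le\<close> and the lower bounds \<open>kpv\<close>,
    \<open>luq\<close> both add up to 2, so all are equalities. Strictness in the open cones then
    identifies \<open>k\<close> with both \<open>i\<close> and \<open>j\<close>.\<close>
  have "\<alpha> i \<bullet> p \<le> \<alpha> k \<bullet> p" "\<alpha> j \<bullet> v \<le> \<alpha> k \<bullet> v" using le up vq kpv luq by linarith+
  then have "k = i" "k = j"
    using strict_cone_ge_imp_eq[OF p' k(1)] strict_cone_ge_imp_eq[OF y(3)[folded v_def] k(1)] by auto
  then show ?thesis using le up vq kpv luq by simp
qed

text \<open>The linear map \<open>r \<mapsto> r + (a \<bullet> r) (f - g)\<close> sends \<open>x - f\<close> to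
  \<open>x - g\<close> for every \<open>x\<close> in the hyperplane of the facet with normal \<open>a\<close>, and fixes the
  directions of that hyperplane.\<close>

lemma spindles_shear:
  fixes f g :: "real ^ 'n"
  assumes pos: "\<And>b. b \<in> A \<Longrightarrow> 0 < 1 + b \<bullet> (f - g)" and a: "a \<in> A"
    and r: "r \<in> spindles (\<lambda>b. b) A f a"
  defines "\<alpha> \<equiv> \<lambda>b. b /\<^sub>R (1 + b \<bullet> (f - g))"
  shows "r + (a \<bullet> r) *\<^sub>R (f - g) \<in> spindles \<alpha> A g a"
    and "\<alpha> a \<bullet> (r + (a \<bullet> r) *\<^sub>R (f - g)) = a \<bullet> r"
proof -
  let ?T = "\<lambda>r. r + (a \<bullet> r) *\<^sub>R (f - g)"
  have \<alpha>: "\<alpha> b \<bullet> y = (b \<bullet> y) / (1 + b \<bullet> (f - g))" for b y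
    by (simp add: \<alpha>_def divide_inverse mult.commute)
  have eq: "\<alpha> a \<bullet> ?T s = a \<bullet> s" for s
  proof -
    have "a \<bullet> ?T s = (a \<bullet> s) * (1 + a \<bullet> (f - g))" by (simp add: inner_add_right algebra_simps)
    then show ?thesis using pos[OF a] by (simp add: \<alpha>)
  qed
  show "\<alpha> a \<bullet> ?T r = a \<bullet> r" by (rule eq)
  have cone: "?T s \<in> strict_cone \<alpha> A a" if s: "s \<in> strict_cone (\<lambda>b. b) A a" for s
    unfolding strict_cone_def
  proof (intro CollectI ballI)
    fix b assume b: "b \<in> A - {a}"
    have "b \<bullet> ?T s = b \<bullet> s + (a \<bullet> s) * (b \<bullet> (f - g))" by (simp add: inner_add_right)
    also have "\<dots> < (a \<bullet> s) * (1 + b \<bullet> (f - g))"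
      using s b by (simp add: strict_cone_def distrib_left)
    finally have "\<alpha> b \<bullet> ?T s < a \<bullet> s"
      using pos[of b] b by (simp add: \<alpha> pos_divide_less_eq)
    then show "\<alpha> b \<bullet> ?T s < \<alpha> a \<bullet> ?T s" by (simp only: eq)
  qed
  obtain x where x: "x \<in> integer_points" "a \<bullet> (x - f) = 1" "x - f - r \<in> strict_cone (\<lambda>b. b) A a"
    and r': "r \<in> strict_cone (\<lambda>b. b) A a" using r by (auto simp: spindles_def)
  have "a \<bullet> (x - f - r) = 1 - a \<bullet> r" using x(2) by (simp add: inner_diff_right)
  then have "?T (x - f - r) = x - g - ?T r" by (simp add: algebra_simps)
  with cone[OF x(3)] have "x - g - ?T r \<in> strict_cone \<alpha> A a" by (simp only:)
  moreover have "\<alpha> a \<bullet> (x - g) = 1"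
  proof -
    have "?T (x - f) = x - g" using x(2) by simp
    then show ?thesis using eq[of "x - f"] x(2) by simp
  qed
  ultimately show "?T r \<in> spindles \<alpha> A g a"
    using cone[OF r'] x(1) by (auto simp: spindles_def)
qed

text \<open>The slack of \<open>g\<close> in the inequality with normal \<open>a\<close> is
  \<open>1 + a \<bullet> (f - g)\<close>, which is positive at interior points; dividing by it
  restores the right-hand side 1.\<close>

lemma facet_description_translate:
  assumes A: "facet_description B f A" and g: "g \<in> interior B"
  shows "\<And>a. a \<in> A \<Longrightarrow> 0 < 1 + a \<bullet> (f - g)"
    and "facet_description B g ((\<lambda>a. a /\<^sub>R (1 + a \<bullet> (f - g))) ` A)"
proof -
  have B: "B = {x. \<forall>a\<in>A. a \<bullet> (x - f) \<le> 1}"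
    and facet: "\<And>a. a \<in> A \<Longrightarrow> (B \<inter> {x. a \<bullet> (x - f) = 1}) facet_of B" and fin: "finite A"
    using A by (auto simp: facet_description_def)
  show pos: "0 < 1 + a \<bullet> (f - g)" if a: "a \<in> A" for a
  proof -
    have a0: "a \<noteq> 0" using facet[OF a] by (auto simp: facet_of_def)
    have "B \<subseteq> {x. a \<bullet> x \<le> 1 + a \<bullet> f}" using a by (subst B) (auto simp: inner_diff_right)
    then have "interior B \<subseteq> {x. a \<bullet> x < 1 + a \<bullet> f}"
      using interior_mono interior_halfspace_le[OF a0] by blast
    then show ?thesis using g by (auto simp: inner_diff_right)
  qed
  define \<alpha> where "\<alpha> a = a /\<^sub>R (1 + a \<bullet> (f - g))" for a
  have \<alpha>: "\<alpha> a \<bullet> (x - g) = (a \<bullet> (x - f) + a \<bullet> (f - g)) / (1 + a \<bullet> (f - g))" for a x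
    by (simp add: \<alpha>_def divide_inverse inner_diff_right algebra_simps)
  have le: "\<alpha> a \<bullet> (x - g) \<le> 1 \<longleftrightarrow> a \<bullet> (x - f) \<le> 1"
    and eq: "\<alpha> a \<bullet> (x - g) = 1 \<longleftrightarrow> a \<bullet> (x - f) = 1" if "a \<in> A" for a x
    using pos[OF that] by (auto simp: \<alpha> pos_divide_le_eq divide_eq_eq)
  have "B = {x. \<forall>a\<in>\<alpha> ` A. a \<bullet> (x - g) \<le> 1}" using B le by auto
  then have "facet_description B g (\<alpha> ` A)"
    unfolding facet_description_def using fin facet eq by auto
  then show "facet_description B g ((\<lambda>a. a /\<^sub>R (1 + a \<bullet> (f - g))) ` A)"
    by (simp add: \<alpha>_def)
qed

lemma facet_description_lattice_free:
  assumes A: "facet_description B f A" and free: "interior B \<inter> integer_points = {}"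
    and x: "x \<in> integer_points"
  shows "\<exists>a\<in>A. 1 \<le> a \<bullet> (x - f)"
proof (rule ccontr)
  assume "\<not> ?thesis"
  then have "x \<in> (\<Inter>a\<in>A. {y. a \<bullet> (y - f) < 1})" by force
  moreover have "open (\<Inter>a\<in>A. {y. a \<bullet> (y - f) < 1})"
    using A by (intro open_INT ballI open_Collect_less continuous_intros) (auto simp: facet_description_def)
  moreover have "(\<Inter>a\<in>A. {y. a \<bullet> (y - f) < 1}) \<subseteq> B"
    using A by (force simp: facet_description_def)
  ultimately have "x \<in> interior B" using interiorI by blast
  then show False using free x by blast
qed

section \<open>The gauge of a bounded lattice-free polyhedron\<close>

lemma facet_description_nonempty:
  fixes B :: "(real ^ 'n) set"
  assumes "facet_description B f A" "bounded B"
  shows "A \<noteq> {}"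
  using assms not_bounded_UNIV[where 'a = "real ^ 'n"] by (auto simp: facet_description_def)

lemma lattice_gauge_Max:
  fixes B :: "(real ^ 'n) set"
  assumes A: "facet_description B f A" and bnd: "bounded B"
    and free: "interior B \<inter> integer_points = {}"
  shows "lattice_gauge f (\<lambda>r. Max ((\<lambda>a. a \<bullet> r) ` A))"
proof
  let ?\<psi> = "\<lambda>r. Max ((\<lambda>a. a \<bullet> r) ` A)"
  have fin: "finite A" and B: "B = {x. \<forall>a\<in>A. a \<bullet> (x - f) \<le> 1}"
    using A by (auto simp: facet_description_def)
  have ne: "A \<noteq> {}" by (rule facet_description_nonempty[OF A bnd])
  have le_iff: "?\<psi> r \<le> c \<longleftrightarrow> (\<forall>a\<in>A. a \<bullet> r \<le> c)" for r c using fin ne by simp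
  have ge: "a \<bullet> r \<le> ?\<psi> r" if "a \<in> A" for a r using fin that by simp
  have scale_le: "?\<psi> (t *\<^sub>R x) \<le> t * ?\<psi> x" if "0 \<le> t" for t x
    unfolding le_iff using that ge by (auto intro: mult_left_mono)
  have scale: "?\<psi> (t *\<^sub>R x) = t * ?\<psi> x" if "0 \<le> t" for t x
  proof (cases "t = 0")
    case True
    have "(\<lambda>a. a \<bullet> (0 :: real ^ 'n)) ` A = {0}" using ne by auto
    then show ?thesis using True by simp
  next
    case False
    then have "?\<psi> x \<le> (1 / t) * ?\<psi> (t *\<^sub>R x)"
      using scale_le[of "1 / t" "t *\<^sub>R x"] that by simp
    then have "t * ?\<psi> x \<le> ?\<psi> (t *\<^sub>R x)"
      using False that by (simp add: pos_le_divide_eq mult.commute)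
    then show ?thesis using scale_le[OF that, of x] by simp
  qed
  show "?\<psi> (t *\<^sub>R x) = t * ?\<psi> x" if "0 \<le> t" for t x by (rule scale[OF that])
  show "?\<psi> (x + y) \<le> ?\<psi> x + ?\<psi> y" for x y
    unfolding le_iff using ge by (auto simp: inner_add_right intro: add_mono)
  show "1 \<le> ?\<psi> (x - f)" if "x \<in> integer_points" for x
  proof -
    obtain a where "a \<in> A" "1 \<le> a \<bullet> (x - f)"
      using facet_description_lattice_free[OF A free \<open>x \<in> integer_points\<close>] by blast
    then show ?thesis using ge[of a "x - f"] by linarith
  qed
  show "\<exists>c>0. \<forall>x. c * norm x \<le> ?\<psi> x"
  proof -
    obtain K where K: "K > 0" "\<And>x. x \<in> B \<Longrightarrow> norm (x - f) \<le> K"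
    proof -
      obtain K0 where "\<And>x. x \<in> B \<Longrightarrow> norm x \<le> K0" using bnd by (auto simp: bounded_iff)
      then have "norm (x - f) \<le> \<bar>K0\<bar> + norm f + 1" if "x \<in> B" for x
        using norm_triangle_ineq4[of x f] that by (smt (verit))
      then show thesis by (intro that[of "\<bar>K0\<bar> + norm f + 1"]) (auto simp: add_nonneg_pos)
    qed
    have "1 / (K + 1) * norm x \<le> ?\<psi> x" for x
    proof (cases "x = 0")
      case True
      then show ?thesis using scale[of 0 x] by simp
    next
      case False
      \<comment> \<open>Rescaled to norm \<open>K + 1\<close>, the vector leads from
        \<open>f\<close> strictly out of \<open>B\<close>, so its gauge exceeds 1; homogeneity gives
        the bound for \<open>x\<close>.\<close>
      define y where "y = ((K + 1) / norm x) *\<^sub>R x"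
      have "norm y = K + 1" using False K by (simp add: y_def)
      then have "f + y \<notin> B" using K(2)[of "f + y"] by auto
      then have "1 < ?\<psi> y" using le_iff[of y 1] by (subst (asm) B) auto
      also have "?\<psi> y = (K + 1) / norm x * ?\<psi> x" unfolding y_def using K by (intro scale) auto
      finally show ?thesis using K False by (simp add: field_simps)
    qed
    then show ?thesis using K by (intro exI[of _ "1 / (K + 1)"]) auto
  qed
  show "\<exists>C>0. \<forall>x. ?\<psi> x \<le> C * norm x"
  proof (intro exI[of _ "1 + (\<Sum>a\<in>A. norm a)"] conjI allI)
    show "0 < 1 + (\<Sum>a\<in>A. norm a)" by (simp add: add_pos_nonneg sum_nonneg)
    fix x
    show "?\<psi> x \<le> (1 + (\<Sum>a\<in>A. norm a)) * norm x"
      unfolding le_iff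
    proof
      fix a assume "a \<in> A"
      then have "norm a \<le> (\<Sum>a\<in>A. norm a)" using fin by (intro member_le_sum) auto
      then have "norm a * norm x \<le> (1 + (\<Sum>a\<in>A. norm a)) * norm x"
        by (intro mult_right_mono) auto
      then show "a \<bullet> x \<le> (1 + (\<Sum>a\<in>A. norm a)) * norm x"
        using norm_cauchy_schwarz[of a x] by linarith
    qed
  qed
qed

text \<open>Off a null set both vectors of a covering pair lie in open cones. A facet not strictly
  satisfied by the lattice point they sum to then forces equality in the covering inequality, so
  both cones belong to that facet and the lattice point lies on its hyperplane.\<close>

lemma covered_imp_spindles:
  fixes B :: "(real ^ 'n) set"
  assumes A: "facet_description B f A" and bnd: "bounded B"
    and free: "interior B \<inter> integer_points = {}"
    and cov: "\<And>r. lattice_gauge.covered f (\<lambda>r. Max ((\<lambda>a. a \<bullet> r) ` A)) r"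
  obtains N where "negligible N"
    "\<And>y. y \<notin> N \<Longrightarrow> \<exists>w\<in>integer_points. w + y \<in> (\<Union>a\<in>A. spindles (\<lambda>b. b) A f a)"
proof
  let ?\<psi> = "\<lambda>r. Max ((\<lambda>a. a \<bullet> r) ` A)"
  let ?Z = "integer_points :: (real ^ 'n) set"
  interpret lattice_gauge f ?\<psi> by (rule lattice_gauge_Max[OF A bnd free])
  have fin: "finite A" and ne: "A \<noteq> {}"
    using A facet_description_nonempty[OF A bnd] by (auto simp: facet_description_def)
  define P where "P = {(a, b). a \<in> A \<and> b \<in> A \<and> a \<noteq> b}"
  have P: "countable P"
    by (rule countable_finite, rule finite_subset[of _ "A \<times> A"]) (auto simp: P_def fin)
  \<comment> \<open>The points where two normals tie on \<open>y + w\<close> or on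
    \<open>w - f - y\<close>: countably many hyperplanes.\<close>
  define N where "N = (\<Union>(w, a, b)\<in>?Z \<times> P.
      {y. (a - b) \<bullet> y = - ((a - b) \<bullet> w)} \<union> {y. (a - b) \<bullet> y = (a - b) \<bullet> (w - f)})"
  show "negligible N"
    unfolding N_def
  proof (intro negligible_countable_Union)
    show "countable ((\<lambda>(w, a, b). {y. (a - b) \<bullet> y = - ((a - b) \<bullet> w)} \<union>
        {y. (a - b) \<bullet> y = (a - b) \<bullet> (w - f)}) ` (?Z \<times> P))"
      using P countable_integer_points by blast
  qed (auto simp: P_def negligible_hyperplane)
  fix y assume y: "y \<notin> N"
  have strict: "\<exists>a\<in>A. r \<in> strict_cone (\<lambda>b. b) A a \<and> ?\<psi> r = a \<bullet> r"
    if neq: "\<And>a b. a \<in> A \<Longrightarrow> b \<in> A \<Longrightarrow> a \<noteq> b \<Longrightarrow> a \<bullet> r \<noteq> b \<bullet> r" for r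
  proof -
    have "?\<psi> r \<in> (\<lambda>a. a \<bullet> r) ` A" using fin ne by (intro Max_in) auto
    then obtain a where a: "a \<in> A" "?\<psi> r = a \<bullet> r" by blast
    have "b \<bullet> r < a \<bullet> r" if "b \<in> A - {a}" for b
    proof -
      have "b \<bullet> r \<le> ?\<psi> r" using fin that by simp
      moreover have "b \<bullet> r \<noteq> a \<bullet> r" using neq a that by blast
      ultimately show ?thesis using a by simp
    qed
    then show ?thesis using a by (auto simp: strict_cone_def)
  qed
  obtain w w' where w: "w \<in> ?Z" "w' \<in> ?Z" "?\<psi> (y + w) + ?\<psi> (w' - f - y) \<le> 1"
    using cov[of y] unfolding covered_def by blast
  define r where "r = y + w"
  define u where "u = w' - f - y"
  have ineqr: "a \<bullet> r \<noteq> b \<bullet> r" and inequ: "a \<bullet> u \<noteq> b \<bullet> u" if ab: "a \<in> A" "b \<in> A" "a \<noteq> b" for a b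
  proof -
    have "(w, a, b) \<in> ?Z \<times> P" "(w', a, b) \<in> ?Z \<times> P" using ab w by (auto simp: P_def)
    then have "(a - b) \<bullet> y \<noteq> - ((a - b) \<bullet> w)" "(a - b) \<bullet> y \<noteq> (a - b) \<bullet> (w' - f)"
      using y unfolding N_def by blast+
    then show "a \<bullet> r \<noteq> b \<bullet> r" "a \<bullet> u \<noteq> b \<bullet> u"
      by (auto simp: r_def u_def inner_diff_left inner_diff_right inner_add_right)
  qed
  obtain a where a: "a \<in> A" "r \<in> strict_cone (\<lambda>b. b) A a" "?\<psi> r = a \<bullet> r"
    using strict[of r] ineqr by blast
  obtain b where b: "b \<in> A" "u \<in> strict_cone (\<lambda>b. b) A b" "?\<psi> u = b \<bullet> u"
    using strict[of u] inequ by blast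
  have ru: "w + w' - f = r + u" by (simp add: r_def u_def)
  obtain c where c: "c \<in> A" "1 \<le> c \<bullet> (w + w' - f)"
    using facet_description_lattice_free[OF A free integer_points_add[OF w(1,2)]] by blast
  have le1: "a \<bullet> r + b \<bullet> u \<le> 1" using w(3) a(3) b(3) by (simp add: r_def u_def)
  have "c \<bullet> r \<le> a \<bullet> r" "c \<bullet> u \<le> b \<bullet> u"
    using strict_cone_le[OF a(2) c(1)] strict_cone_le[OF b(2) c(1)] by auto
  moreover have c1: "1 \<le> c \<bullet> r + c \<bullet> u" using c(2) by (simp add: ru inner_add_right)
  ultimately have eq: "c = a" "c = b"
    using strict_cone_ge_imp_eq[OF a(2) c(1)] strict_cone_ge_imp_eq[OF b(2) c(1)] le1 by linarith+
  then have "a \<bullet> (w + w' - f) = 1" using c1 le1 by (simp add: ru inner_add_right)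
  moreover have "(w + w') - f - r = u" by (simp add: r_def u_def)
  ultimately have "r \<in> spindles (\<lambda>b. b) A f a"
    using a b eq integer_points_add[OF w(1,2)] unfolding spindles_def by blast
  then show "\<exists>w\<in>?Z. w + y \<in> (\<Union>a\<in>A. spindles (\<lambda>b. b) A f a)"
    using a(1) w(1) by (auto simp: r_def add.commute)
qed

lemma spindles_covered:
  fixes \<alpha> :: "'i \<Rightarrow> real ^ 'n"
  assumes lg: "lattice_gauge f (\<lambda>r. Max ((\<lambda>i. \<alpha> i \<bullet> r) ` I))"
    and fin: "finite I" and i: "i \<in> I"
    and w: "w \<in> integer_points" and r: "w + y \<in> spindles \<alpha> I f i"
  shows "lattice_gauge.covered f (\<lambda>r. Max ((\<lambda>i. \<alpha> i \<bullet> r) ` I)) y"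
proof -
  interpret lattice_gauge f "\<lambda>r. Max ((\<lambda>i. \<alpha> i \<bullet> r) ` I)" by (rule lg)
  obtain x where x: "x \<in> integer_points" "\<alpha> i \<bullet> (x - f) = 1"
      "x - f - (w + y) \<in> strict_cone \<alpha> I i" and r': "w + y \<in> strict_cone \<alpha> I i"
    using r by (auto simp: spindles_def)
  have Max: "Max ((\<lambda>i. \<alpha> i \<bullet> s) ` I) = \<alpha> i \<bullet> s" if "s \<in> strict_cone \<alpha> I i" for s
    using fin i strict_cone_le[OF that] by (intro Max_eqI) auto
  have eq: "y + w = w + y" "x - w - f - y = x - f - (w + y)" by (simp_all add: algebra_simps)
  have "Max ((\<lambda>i. \<alpha> i \<bullet> (y + w)) ` I) + Max ((\<lambda>i. \<alpha> i \<bullet> (x - w - f - y)) ` I)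
      = \<alpha> i \<bullet> (w + y) + \<alpha> i \<bullet> (x - f - (w + y))"
    unfolding eq using Max r' x(3) by simp
  also have "\<dots> \<le> 1" using x(2) by (simp add: inner_diff_right)
  finally show ?thesis
    unfolding covered_def using w integer_points_diff[OF x(1) w] by blast
qed

text \<open>The sheared pieces of a fundamental domain for \<open>f\<close> stay injective modulo the
  lattice, so their total volume, which depends affinely on \<open>g\<close>, is at most 1. It equals 1 at the
  interior point \<open>g = f\<close>, hence everywhere.\<close>

lemma covered_transfer:
  fixes B :: "(real ^ 'n) set"
  assumes A: "facet_description B f A" and bnd: "bounded B"
    and free: "interior B \<inter> integer_points = {}"
    and f: "f \<in> interior B" and g: "g \<in> interior B"
    and cov: "\<And>r. lattice_gauge.covered f (\<lambda>r. Max ((\<lambda>a. a \<bullet> r) ` A)) r"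
  defines "\<alpha> \<equiv> \<lambda>h a. a /\<^sub>R (1 + a \<bullet> (f - h))"
  shows "lattice_gauge.covered g (\<lambda>r. Max ((\<lambda>a. \<alpha> g a \<bullet> r) ` A)) r"
proof -
  have fin: "finite A" using A by (simp add: facet_description_def)
  let ?S = "\<lambda>a. spindles (\<lambda>b. b) A f a"
  obtain N where N: "negligible N" "\<And>y. y \<notin> N \<Longrightarrow> \<exists>w\<in>integer_points. w + y \<in> (\<Union>a\<in>A. ?S a)"
    using covered_imp_spindles[OF A bnd free cov] by blast
  have opS: "open (?S a)" for a by (rule open_spindles[OF fin])
  obtain S0 where S0: "S0 \<subseteq> (\<Union>a\<in>A. ?S a)" "S0 \<in> sets lebesgue" "lattice_injective S0"
      "emeasure lebesgue S0 = 1"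
    by (rule lattice_injective_representatives[OF open_lebesgue N]) (use opS in \<open>auto intro: open_UN\<close>)
  define S where "S a = S0 \<inter> ?S a" for a
  have "S0 \<in> lmeasurable" using S0(2,4) by (simp add: fmeasurable_def)
  then have Slm: "S a \<in> lmeasurable" for a
    unfolding S_def by (rule fmeasurable_Int_fmeasurable) (rule open_lebesgue[OF opS])
  have disj: "pairwise (\<lambda>a b. disjnt (S a) (S b)) A"
  proof (rule pairwiseI, rule ccontr)
    fix a b assume ab: "a \<in> A" "b \<in> A" "a \<noteq> b" and "\<not> disjnt (S a) (S b)"
    then obtain r where "r \<in> strict_cone (\<lambda>b. b) A a" "r \<in> strict_cone (\<lambda>b. b) A b"
      by (auto simp: disjnt_def S_def spindles_def)
    then show False
      using ab strict_cone_le[of r "\<lambda>b. b" A b a] strict_cone_ge_imp_eq[of r "\<lambda>b. b" A a b] by simp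
  qed
  have "(\<Union>a\<in>A. S a) = S0" using S0(1) by (auto simp: S_def)
  then have total: "(\<Sum>a\<in>A. measure lebesgue (S a)) = 1"
    using measure_UNION'[OF fin Slm disj] S0(4) by (simp add: measure_def)
  define T where "T h a r = r + (a \<bullet> r) *\<^sub>R (f - h)" for h a r
  define D where "D h = (\<Union>a\<in>A. T h a ` S a)" for h
  have TS: "T h a r \<in> spindles (\<alpha> h) A h a" "\<alpha> h a \<bullet> T h a r = a \<bullet> r"
    if "h \<in> interior B" "a \<in> A" "r \<in> S a" for h a r
    using spindles_shear[OF facet_description_translate(1)[OF A that(1)] that(2), of r] that(3)
    by (auto simp: S_def T_def \<alpha>_def)
  have collide: "a = b \<and> r = s"
    if h: "h \<in> interior B" and ab: "a \<in> A" "b \<in> A" and rs: "r \<in> S a" "s \<in> S b"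
      and Z: "T h a r - T h b s \<in> integer_points" for h a b r s
  proof -
    have "\<exists>k\<in>A. 1 \<le> \<alpha> h k \<bullet> (x - h)" if "x \<in> integer_points" for x
      using facet_description_lattice_free[OF facet_description_translate(2)[OF A h] free that]
      by (simp add: \<alpha>_def)
    then have *: "a = b \<and> \<alpha> h a \<bullet> T h a r = \<alpha> h a \<bullet> T h b s"
      using spindles_collision[OF _ TS(1)[OF h ab(1) rs(1)] TS(1)[OF h ab(2) rs(2)] Z] by blast
    then have eq: "a = b" by simp
    have "a \<bullet> r = a \<bullet> s"
      using conjunct2[OF *] TS(2)[OF h ab(1) rs(1)] TS(2)[OF h ab(2) rs(2)] unfolding eq by simp
    \<comment> \<open>Equal values under \<open>a\<close> make the shear terms cancel, so the
      congruence of the images is one of \<open>r\<close> and \<open>s\<close> themselves.\<close>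
    then have "r - s \<in> integer_points" using Z by (simp add: T_def eq)
    moreover have "r \<in> S0" "s \<in> S0" using rs by (auto simp: S_def)
    ultimately show ?thesis using eq S0(3) unfolding lattice_injective_def by blast
  qed
  have injD: "lattice_injective (D h)" if "h \<in> interior B" for h
    using collide[OF that] unfolding lattice_injective_def D_def by blast
  have DTlm: "T h a ` S a \<in> lmeasurable"
    and mT: "measure lebesgue (T h a ` S a) = (1 + a \<bullet> (f - h)) * measure lebesgue (S a)"
    if "h \<in> interior B" "a \<in> A" for h a
    using measure_rank_one_update[OF Slm[of a], of a "f - h"]
      facet_description_translate(1)[OF A that] by (auto simp: T_def[abs_def])
  have Dlm: "D h \<in> lmeasurable" if "h \<in> interior B" for h
    unfolding D_def using fin DTlm[OF that] by (intro fmeasurable.finite_UN) auto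
  \<comment> \<open>The volume-weighted sum of the normals: the volume of \<open>D h\<close> is
    \<open>1 + c \<bullet> (f - h)\<close>, so \<open>c\<close> is its gradient up to sign.\<close>
  define c where "c = (\<Sum>a\<in>A. measure lebesgue (S a) *\<^sub>R a)"
  have mD: "measure lebesgue (D h) = 1 + c \<bullet> (f - h)" if h: "h \<in> interior B" for h
  proof -
    have disjT: "pairwise (\<lambda>a b. disjnt (T h a ` S a) (T h b ` S b)) A"
    proof (rule pairwiseI, rule ccontr)
      fix a b assume ab: "a \<in> A" "b \<in> A" "a \<noteq> b" and "\<not> disjnt (T h a ` S a) (T h b ` S b)"
      then obtain r s where "r \<in> S a" "s \<in> S b" "T h a r = T h b s" unfolding disjnt_def by blast
      then show False using collide[OF h ab(1,2)] ab(3) by force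
    qed
    have "measure lebesgue (D h) = (\<Sum>a\<in>A. measure lebesgue (T h a ` S a))"
      unfolding D_def by (rule measure_UNION'[OF fin DTlm[OF h] disjT])
    also have "\<dots> = (\<Sum>a\<in>A. (1 + a \<bullet> (f - h)) * measure lebesgue (S a))"
      using mT[OF h] by simp
    also have "\<dots> = 1 + c \<bullet> (f - h)"
      by (simp add: c_def inner_sum_left distrib_right sum.distrib total) (simp only: mult.commute)
    finally show ?thesis .
  qed
  have le: "c \<bullet> (f - h) \<le> 0" if h: "h \<in> interior B" for h
  proof -
    have "emeasure lebesgue (D h) \<le> 1"
      using Dlm[OF h] by (intro emeasure_lattice_injective_le_1 injD[OF h]) (auto simp: fmeasurable_def)
    then have "measure lebesgue (D h) \<le> 1"
      using Dlm[OF h] by (simp add: emeasure_eq_measure2)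
    then show ?thesis using mD[OF h] by simp
  qed
  have "c = 0"
  proof -
    obtain e where e: "e > 0" "ball f e \<subseteq> interior B"
      using f open_interior open_contains_ball by blast
    \<comment> \<open>A step from \<open>f\<close> against \<open>c\<close> of length below
      \<open>e\<close>, with 1 added in case \<open>c = 0\<close>. At
      \<open>h = f - t *\<^sub>R c\<close> the bound \<open>le\<close> reads
      \<open>t * (c \<bullet> c) \<le> 0\<close>.\<close>
    define t where "t = e / (2 * (norm c + 1))"
    have t: "t > 0" using e by (simp add: t_def add_nonneg_pos)
    have "norm (t *\<^sub>R c) < e"
    proof -
      have "t * norm c \<le> t * (norm c + 1)" using t by simp
      also have "\<dots> = e / 2"
        using norm_ge_zero[of c] unfolding t_def by (simp add: field_simps add_nonneg_eq_0_iff)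
      finally show ?thesis using e t by simp
    qed
    then have "f - t *\<^sub>R c \<in> interior B" using e by (auto simp: dist_norm)
    from le[OF this] have "t * (c \<bullet> c) \<le> 0" by simp
    then have "c \<bullet> c \<le> 0" using t by (simp add: mult_le_0_iff)
    then show ?thesis by (metis inner_gt_zero_iff not_le)
  qed
  then have D1: "emeasure lebesgue (D g) = 1"
    using mD[OF g] Dlm[OF g] by (simp add: emeasure_eq_measure2)
  have gauge: "lattice_gauge g (\<lambda>r. Max ((\<lambda>a. \<alpha> g a \<bullet> r) ` A))"
    using lattice_gauge_Max[OF facet_description_translate(2)[OF A g] bnd free]
    by (simp add: \<alpha>_def image_image)
  interpret lattice_gauge g "\<lambda>r. Max ((\<lambda>a. \<alpha> g a \<bullet> r) ` A)" by (rule gauge)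
  show ?thesis
  proof (rule ccontr)
    assume "\<not> covered r"
    \<comment> \<open>\<open>D g\<close> has full volume in the torus, so a translate of it meets
      the open uncovered set; but \<open>D g\<close> consists of spindle points for
      \<open>g\<close>, which are covered.\<close>
    then obtain y w where y: "\<not> covered y" "w \<in> integer_points" "w + y \<in> D g"
      using lattice_injective_meets_open[OF _ injD[OF g] D1 open_uncovered] Dlm[OF g]
      by (auto simp: fmeasurable_def)
    then obtain a s where "a \<in> A" "s \<in> S a" "w + y = T g a s" by (auto simp: D_def)
    then have "covered y"
      using spindles_covered[OF gauge fin _ y(2)] TS(1)[OF g] by metis
    then show False using y(1) by simp
  qed
qed

section \<open>Full dimension of the polytope, and the dichotomy\<close>

lemma maximal_lattice_free_polytope_body:
  fixes B :: "(real ^ 'n) set"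
  assumes card: "CARD('n) \<ge> 2" and max: "maximal_lattice_free B" and poly: "polytope B"
  shows "maximal_lattice_free_body B"
proof -
  have "aff_dim B = int CARD('n)"
  proof (rule ccontr)
    assume "aff_dim B \<noteq> int CARD('n)"
    then have "aff_dim B < DIM(real ^ 'n)" using aff_dim_le_DIM[of B] by simp
    then obtain a b where ab: "a \<noteq> 0" "B \<subseteq> {x. a \<bullet> x = b}"
      by (rule aff_lowdim_subset_hyperplane)
    let ?H = "{x. a \<bullet> x = b}"
    \<comment> \<open>This is where \<open>CARD('n) \<ge> 2\<close> enters: the hyperplane is
      unbounded, so it is a lattice-free set properly containing the bounded set
      \<open>B\<close>.\<close>
    have dimH: "aff_dim ?H \<ge> 1" using ab(1) card by (simp add: aff_dim_hyperplane)
    have "\<not> bounded ?H"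
      using affine_bounded_eq_trivial[OF affine_hyperplane[of a b]] dimH by auto
    then have "B \<noteq> ?H" using polytope_imp_bounded[OF poly] by blast
    moreover have "lattice_free ?H"
      using ab(1) by (simp add: lattice_free_def convex_hyperplane)
    ultimately show False using max ab(2) unfolding maximal_lattice_free_def by blast
  qed
  then show ?thesis
    using max polytope_imp_compact[OF poly] by (simp add: maximal_lattice_free_body_def)
qed

theorem theorem1:
  fixes B :: "(real ^ 'n) set"
  assumes "CARD('n) \<ge> 2"
    and "maximal_lattice_free B"
    and "simplicial_polytope B"
  shows "unique_lifting_body B \<or> multiple_lifting_body B"
proof -
  have poly: "polytope B" using assms(3) by (simp add: simplicial_polytope_def)
  have body: "maximal_lattice_free_body B"
    using maximal_lattice_free_polytope_body[OF assms(1,2) poly] .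
  have free: "interior B \<inter> integer_points = {}"
    using assms(2) by (simp add: maximal_lattice_free_def lattice_free_def)
  have bnd: "bounded B" by (rule polytope_imp_bounded[OF poly])
  have facets: "facet_description B f (facet_normals B f)" if "f \<in> interior B" for f
    by (rule facet_description_facet_normals[OF polytope_imp_polyhedron[OF poly] that])
  have gauge_eq: "body_gauge B f = (\<lambda>r. Max ((\<lambda>a. a \<bullet> r) ` facet_normals B f))" for f
    by (simp add: fun_eq_iff body_gauge_def)
  have gauge: "lattice_gauge f (body_gauge B f)" if "f \<in> interior B" for f
    unfolding gauge_eq by (rule lattice_gauge_Max[OF facets[OF that] bnd free])
  let ?U = "\<lambda>f. \<exists>!\<pi>. minimal_lifting f (body_gauge B f) \<pi>"
  have U_iff: "?U f \<longleftrightarrow> (\<forall>r. lattice_gauge.covered f (body_gauge B f) r)" if "f \<in> interior B" for f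
    by (rule lattice_gauge.unique_minimal_lifting_iff_covered[OF gauge[OF that]])
  have transfer: "?U g" if f: "f \<in> interior B" and g: "g \<in> interior B" and U: "?U f" for f g
  proof -
    let ?\<alpha> = "\<lambda>a. a /\<^sub>R (1 + a \<bullet> (f - g))"
    have "facet_normals B g = ?\<alpha> ` facet_normals B f"
      using facet_description_unique[OF polytope_imp_polyhedron[OF poly] g] facets[OF g]
        facet_description_translate(2)[OF facets[OF f] g] by blast
    then have "body_gauge B g = (\<lambda>r. Max ((\<lambda>a. ?\<alpha> a \<bullet> r) ` facet_normals B f))"
      by (simp only: gauge_eq image_image)
    moreover have "lattice_gauge.covered g (\<lambda>r. Max ((\<lambda>a. ?\<alpha> a \<bullet> r) ` facet_normals B f)) r" for r
      using covered_transfer[OF facets[OF f] bnd free f g] U U_iff[OF f] unfolding gauge_eq by blast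
    ultimately show ?thesis using U_iff[OF g] by simp
  qed
  show ?thesis
  proof (cases "\<exists>f\<in>interior B. ?U f")
    case True
    then have "unique_lifting_body B"
      unfolding unique_lifting_body_def using body transfer by blast
    then show ?thesis by blast
  next
    case False
    have "\<exists>\<pi> \<pi>'. \<pi> \<noteq> \<pi>' \<and> minimal_lifting f (body_gauge B f) \<pi> \<and>
        minimal_lifting f (body_gauge B f) \<pi>'" if f: "f \<in> interior B" for f
    proof -
      obtain \<pi> where "minimal_lifting f (body_gauge B f) \<pi>"
        using minimal_lifting_exists[OF lattice_gauge.lifting_gauge[OF gauge[OF f]]] by blast
      then show ?thesis using False f by metis
    qed
    then have "multiple_lifting_body B"
      unfolding multiple_lifting_body_def using body by blast
    then show ?thesis by blast
  qed
qed

end
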